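(* Let $\mathcal{H}$ be a commutative finite-dimensional Hopf algebra over a field $\mathbb{K}$ of characteristic zero, let $\mathcal{A}$ be a right $\mathcal{H}$-comodule algebra with coinvariant subalgebra $\mathcal{B}$, let $\sigma:\mathcal{A}\to\mathcal{A}$ be an algebra map and $\delta:\mathcal{A}\to\mathcal{A}$ a $\sigma$-derivation, and assume both $\sigma$ and $\delta$ are morphisms of $\mathcal{H}$-comodules. Let $\mathcal{T}=\mathcal{A}[X,\sigma,\delta]$ and $\mathcal{S}=\mathcal{B}[X,\sigma,\delta]$. (1) The center $\mathcal{Z}$ of $\mathcal{A}$ and $\mathcal{A}^\sigma\cap\mathcal{A}^\delta\cap\mathcal{Z}$ are $\mathcal{H}$-comodule subalgebras of $\mathcal{A}$, and the algebra of coinvariant elements of $\mathcal{A}^\sigma\cap\mathcal{A}^\delta\cap\mathcal{Z}$ is $\mathcal{B}^\sigma\cap\mathcal{B}^\delta\cap\mathcal{Z}$. (2) If $\mathcal{B}^\sigma\cap\mathcal{B}^\delta\cap\mathcal{Z}\subseteq\mathcal{A}^\sigma\cap\mathcal{A}^\delta\cap\mathcal{Z}$ is an $\mathcal{H}$-Galois extension, then $\mathcal{S}\subseteq\mathcal{T}$ is a centrally $\mathcal{H}$-Galois extension.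
   Context: $\mathcal{A}$ is a right $\mathcal{H}$-comodule algebra via an algebra map $\rho(a)=\sum a_{\langle0\rangle}\otimes a_{\langle1\rangle}$; $\mathcal{B}=\{a:\rho(a)=a\otimes1\}$. A $\sigma$-derivation satisfies $\delta(ab)=\sigma(a)\delta(b)+\delta(a)b$. The Ore extension $\mathcal{A}[X,\sigma,\delta]$ is the free left $\mathcal{A}$-module with basis $1,X,X^2,\dots$ and multiplication determined by $X^nX^m=X^{n+m}$ and $Xa=\sigma(a)X+\delta(a)$; since $\sigma,\delta$ preserve $\mathcal{B}$, $\mathcal{B}[X,\sigma,\delta]$ is its subalgebra. $\mathcal{T}$ is an $\mathcal{H}$-comodule algebra via $\rho_{\mathcal{T}}(aX^n)=\sum a_{\langle0\rangle}X^n\otimes a_{\langle1\rangle}$, whose coinvariant subalgebra is $\mathcal{S}$. $\mathcal{A}^\sigma=\{a:\sigma(a)=a\}$, $\mathcal{A}^\delta=\{a:\delta(a)=0\}$, similarly for $\mathcal{B}$. An extension of coinvariants $\mathcal{C}'\subseteq\mathcal{C}$ is $\mathcal{H}$-Galois if $\mathcal{C}\otimes_{\mathcal{C}'}\mathcal{C}\to\mathcal{C}\otimes\mathcal{H}$, $c\otimes x\mapsto\sum cx_{\langle0\rangle}\otimes x_{\langle1\rangle}$, is bijective. An $\mathcal{H}$-comodule algebra $\mathcal{C}$ with coinvariants $\mathcal{C}'$ is centrally $\mathcal{H}$-Galois over $\mathcal{C}'$ if its center $Z(\mathcal{C})$ is a subcomodule and $Z(\mathcal{C})^{\mathrm{co}\mathcal{H}}\subseteq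 Z(\mathcal{C})$ is an $\mathcal{H}$-Galois extension with $Z(\mathcal{C})$ faithfully flat over $Z(\mathcal{C})^{\mathrm{co}\mathcal{H}}$. *)

theory Defs
  imports "HOL-Computational_Algebra.Polynomial" "HOL-Algebra.Module"
begin

text \<open>A finite-dimensional Hopf algebra H over a field K is given by a finite basis
 (e_i), i ranging over the finite type 'i; elements of H are coordinate vectors
 'i => K, elements of H (x) H are coordinate vectors 'i * 'i => K. Structure constants:
   e_i e_j = sum_k mu i j k e_k,   1 = sum_k un k e_k,
   Delta e_k = sum_(i,j) com k i j e_i (x) e_j,   eps(e_k) = eps k,
   S e_k = sum_l ant k l e_l.\<close>

definition hbasis :: "'i \<Rightarrow> 'i \<Rightarrow> 'k::field" where
  "hbasis a = (\<lambda>j. if j = a then 1 else 0)"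

definition hmul :: "('i::finite \<Rightarrow> 'i \<Rightarrow> 'i \<Rightarrow> 'k::field) \<Rightarrow> ('i \<Rightarrow> 'k) \<Rightarrow> ('i \<Rightarrow> 'k) \<Rightarrow> ('i \<Rightarrow> 'k)" where
  "hmul mu x y = (\<lambda>k. \<Sum>i\<in>UNIV. \<Sum>j\<in>UNIV. x i * y j * mu i j k)"

definition hcomul :: "('i::finite \<Rightarrow> 'i \<Rightarrow> 'i \<Rightarrow> 'k::field) \<Rightarrow> ('i \<Rightarrow> 'k) \<Rightarrow> ('i \<times> 'i \<Rightarrow> 'k)" where
  "hcomul com x = (\<lambda>(a, b). \<Sum>k\<in>UNIV. x k * com k a b)"

definition hcounit :: "('i::finite \<Rightarrow> 'k::field) \<Rightarrow> ('i \<Rightarrow> 'k) \<Rightarrow> 'k" where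
  "hcounit eps x = (\<Sum>k\<in>UNIV. x k * eps k)"

definition hantipode :: "('i::finite \<Rightarrow> 'i \<Rightarrow> 'k::field) \<Rightarrow> ('i \<Rightarrow> 'k) \<Rightarrow> ('i \<Rightarrow> 'k)" where
  "hantipode ant x = (\<lambda>l. \<Sum>k\<in>UNIV. x k * ant k l)"

text \<open>Multiplication of H (x) H: (a (x) b)(c (x) d) = ac (x) bd.\<close>
definition t2mul :: "('i::finite \<Rightarrow> 'i \<Rightarrow> 'i \<Rightarrow> 'k::field) \<Rightarrow> ('i \<times> 'i \<Rightarrow> 'k) \<Rightarrow> ('i \<times> 'i \<Rightarrow> 'k) \<Rightarrow> ('i \<times> 'i \<Rightarrow> 'k)" where
  "t2mul mu X Y = (\<lambda>(k, l). \<Sum>a\<in>UNIV. \<Sum>b\<in>UNIV. \<Sum>c\<in>UNIV. \<Sum>d\<in>UNIV.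
      X (a, b) * Y (c, d) * mu a c k * mu b d l)"

definition hopf_algebra ::
  "('i::finite \<Rightarrow> 'i \<Rightarrow> 'i \<Rightarrow> 'k::field) \<Rightarrow> ('i \<Rightarrow> 'k) \<Rightarrow> ('i \<Rightarrow> 'i \<Rightarrow> 'i \<Rightarrow> 'k)
    \<Rightarrow> ('i \<Rightarrow> 'k) \<Rightarrow> ('i \<Rightarrow> 'i \<Rightarrow> 'k) \<Rightarrow> bool" where
  "hopf_algebra mu un com eps ant \<longleftrightarrow>
     \<comment> \<open>associative unital algebra\<close>
     (\<forall>x y z. hmul mu (hmul mu x y) z = hmul mu x (hmul mu y z)) \<and>
     (\<forall>x. hmul mu un x = x \<and> hmul mu x un = x) \<and>
     \<comment> \<open>coassociative counital coalgebra\<close>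
     (\<forall>x a b c. (\<Sum>i\<in>UNIV. hcomul com x (i, c) * com i a b)
              = (\<Sum>j\<in>UNIV. hcomul com x (a, j) * com j b c)) \<and>
     (\<forall>x. (\<lambda>b. \<Sum>a\<in>UNIV. eps a * hcomul com x (a, b)) = x) \<and>
     (\<forall>x. (\<lambda>a. \<Sum>b\<in>UNIV. hcomul com x (a, b) * eps b) = x) \<and>
     \<comment> \<open>comultiplication and counit are algebra maps\<close>
     (\<forall>x y. hcomul com (hmul mu x y) = t2mul mu (hcomul com x) (hcomul com y)) \<and>
     hcomul com un = (\<lambda>(a, b). un a * un b) \<and>
     (\<forall>x y. hcounit eps (hmul mu x y) = hcounit eps x * hcounit eps y) \<and>
     hcounit eps un = 1 \<and>
     \<comment> \<open>antipode: m(S (x) id)Delta = m(id (x) S)Delta = eta eps\<close>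
     (\<forall>x. (\<lambda>k. \<Sum>a\<in>UNIV. \<Sum>b\<in>UNIV. hcomul com x (a, b) *
               hmul mu (hantipode ant (hbasis a)) (hbasis b) k) = (\<lambda>k. hcounit eps x * un k)) \<and>
     (\<forall>x. (\<lambda>k. \<Sum>a\<in>UNIV. \<Sum>b\<in>UNIV. hcomul com x (a, b) *
               hmul mu (hbasis a) (hantipode ant (hbasis b)) k) = (\<lambda>k. hcounit eps x * un k))"

definition commutative_hopf_algebra where
  "commutative_hopf_algebra mu un com eps ant \<longleftrightarrow>
     hopf_algebra mu un com eps ant \<and> (\<forall>x y. hmul mu x y = hmul mu y x)"

text \<open>A K-algebra structure on a ring 'a: a ring homomorphism K -> centre of 'a;
  scalar multiplication is c . a = alg c * a.\<close>
definition k_algebra :: "('k::field \<Rightarrow> 'a::ring_1) \<Rightarrow> bool" where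
  "k_algebra alg \<longleftrightarrow> (\<forall>x y. alg (x + y) = alg x + alg y) \<and> (\<forall>x y. alg (x * y) = alg x * alg y)
     \<and> alg 1 = 1 \<and> (\<forall>c a. alg c * a = a * alg c)"

text \<open>A right H-comodule structure rho : A -> A (x) H is encoded by its coordinates:
  rho(a) = sum_i (rho a i) (x) e_i.\<close>
definition comodule_algebra ::
  "('i::finite \<Rightarrow> 'i \<Rightarrow> 'i \<Rightarrow> 'k::field) \<Rightarrow> ('i \<Rightarrow> 'k) \<Rightarrow> ('i \<Rightarrow> 'i \<Rightarrow> 'i \<Rightarrow> 'k) \<Rightarrow> ('i \<Rightarrow> 'k)
     \<Rightarrow> ('k \<Rightarrow> 'a::ring_1) \<Rightarrow> ('a \<Rightarrow> 'i \<Rightarrow> 'a) \<Rightarrow> bool" where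
  "comodule_algebra mu un com eps alg rho \<longleftrightarrow>
     k_algebra alg \<and>
     \<comment> \<open>K-linearity\<close>
     (\<forall>a b i. rho (a + b) i = rho a i + rho b i) \<and>
     (\<forall>c a i. rho (alg c * a) i = alg c * rho a i) \<and>
     \<comment> \<open>coassociativity (rho (x) id) rho = (id (x) Delta) rho\<close>
     (\<forall>a i j. rho (rho a i) j = (\<Sum>k\<in>UNIV. alg (com k j i) * rho a k)) \<and>
     \<comment> \<open>counit (id (x) eps) rho = id\<close>
     (\<forall>a. (\<Sum>k\<in>UNIV. alg (eps k) * rho a k) = a) \<and>
     \<comment> \<open>rho is an algebra map\<close>
     (\<forall>a b k. rho (a * b) k = (\<Sum>i\<in>UNIV. \<Sum>j\<in>UNIV. alg (mu i j k) * rho a i * rho b j)) \<and>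
     (\<forall>k. rho 1 k = alg (un k))"

text \<open>Coinvariants: rho(x) = x (x) 1 = sum_i (un i . x) (x) e_i.  The argument unitc i is
  the scalar un i viewed inside the algebra.\<close>
definition coinv :: "('c \<Rightarrow> 'c \<Rightarrow> 'c) \<Rightarrow> ('i \<Rightarrow> 'c) \<Rightarrow> ('c \<Rightarrow> 'i \<Rightarrow> 'c) \<Rightarrow> 'c set \<Rightarrow> 'c set" where
  "coinv mlt unitc rho X = {x \<in> X. \<forall>i. rho x i = mlt (unitc i) x}"

definition center :: "('c \<Rightarrow> 'c \<Rightarrow> 'c) \<Rightarrow> 'c set \<Rightarrow> 'c set" where
  "center mlt C = {z \<in> C. \<forall>x\<in>C. mlt z x = mlt x z}"

text \<open>H-comodule subalgebra: a K-subalgebra C (contains the scalars, closed under + and *,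
  hence a K-subspace) with rho(C) \<subseteq> C (x) H, i.e. all coordinates of rho lie in C.\<close>
definition comodule_subalgebra :: "('k \<Rightarrow> 'c::ab_group_add) \<Rightarrow> ('c \<Rightarrow> 'c \<Rightarrow> 'c) \<Rightarrow> ('c \<Rightarrow> 'i \<Rightarrow> 'c) \<Rightarrow> 'c set \<Rightarrow> bool" where
  "comodule_subalgebra alg mlt rho C \<longleftrightarrow>
     range alg \<subseteq> C \<and> (\<forall>x\<in>C. \<forall>y\<in>C. x + y \<in> C \<and> mlt x y \<in> C) \<and> (\<forall>x\<in>C. \<forall>i. rho x i \<in> C)"

definition k_algebra_endo :: "('k::field \<Rightarrow> 'a::ring_1) \<Rightarrow> ('a \<Rightarrow> 'a) \<Rightarrow> bool" where
  "k_algebra_endo alg \<sigma> \<longleftrightarrow> (\<forall>a b. \<sigma> (a + b) = \<sigma> a + \<sigma> b) \<and> (\<forall>a b. \<sigma> (a * b) = \<sigma> a * \<sigma> b)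
     \<and> \<sigma> 1 = 1 \<and> (\<forall>c a. \<sigma> (alg c * a) = alg c * \<sigma> a)"

definition sigma_derivation :: "('k::field \<Rightarrow> 'a::ring_1) \<Rightarrow> ('a \<Rightarrow> 'a) \<Rightarrow> ('a \<Rightarrow> 'a) \<Rightarrow> bool" where
  "sigma_derivation alg \<sigma> \<delta> \<longleftrightarrow> (\<forall>a b. \<delta> (a + b) = \<delta> a + \<delta> b) \<and> (\<forall>c a. \<delta> (alg c * a) = alg c * \<delta> a)
     \<and> (\<forall>a b. \<delta> (a * b) = \<sigma> a * \<delta> b + \<delta> a * b)"

definition comodule_map :: "('a \<Rightarrow> 'i \<Rightarrow> 'a) \<Rightarrow> ('a \<Rightarrow> 'a) \<Rightarrow> bool" where
  "comodule_map rho f \<longleftrightarrow> (\<forall>a i. rho (f a) i = f (rho a i))"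

text \<open>Elements of A[X,sigma,delta] are represented by their (left) coefficient sequences
  sum_n a_n X^n, i.e. by 'a poly; addition is coefficientwise, multiplication is ore_mult.\<close>

definition lmul :: "'a::ring_1 \<Rightarrow> 'a poly \<Rightarrow> 'a poly" where
  "lmul a p = (\<Sum>i\<le>degree p. monom (a * coeff p i) i)"

text \<open>Left multiplication by X: X (b X^i) = sigma(b) X^(i+1) + delta(b) X^i.\<close>
definition xmul :: "('a::ring_1 \<Rightarrow> 'a) \<Rightarrow> ('a \<Rightarrow> 'a) \<Rightarrow> 'a poly \<Rightarrow> 'a poly" where
  "xmul \<sigma> \<delta> p = (\<Sum>i\<le>degree p. monom (\<sigma> (coeff p i)) (Suc i) + monom (\<delta> (coeff p i)) i)"

definition ore_mult :: "('a::ring_1 \<Rightarrow> 'a) \<Rightarrow> ('a \<Rightarrow> 'a) \<Rightarrow> 'a poly \<Rightarrow> 'a poly \<Rightarrow> 'a poly" where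
  "ore_mult \<sigma> \<delta> p q = (\<Sum>n\<le>degree p. lmul (coeff p n) ((xmul \<sigma> \<delta> ^^ n) q))"

text \<open>Comodule structure of T: rho_T(a X^n) = sum a_<0> X^n (x) a_<1>.\<close>
definition ore_rho :: "('a::ring_1 \<Rightarrow> 'i \<Rightarrow> 'a) \<Rightarrow> 'a poly \<Rightarrow> 'i \<Rightarrow> 'a poly" where
  "ore_rho rho p i = map_poly (\<lambda>a. rho a i) p"

definition fsupp :: "('x \<Rightarrow> int) \<Rightarrow> 'x set" where
  "fsupp s = {p. s p \<noteq> 0}"

definition formal_on :: "('x \<Rightarrow> int) \<Rightarrow> 'x set \<Rightarrow> bool" where
  "formal_on s X \<longleftrightarrow> finite (fsupp s) \<and> fsupp s \<subseteq> X"

definition fsing :: "'x \<Rightarrow> ('x \<Rightarrow> int)" where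
  "fsing x = (\<lambda>p. if p = x then 1 else 0)"

inductive_set zspan :: "('x \<Rightarrow> int) set \<Rightarrow> ('x \<Rightarrow> int) set" for G where
  zspan_zero: "(\<lambda>_. 0) \<in> zspan G"
| zspan_gen: "g \<in> G \<Longrightarrow> g \<in> zspan G"
| zspan_add: "a \<in> zspan G \<Longrightarrow> b \<in> zspan G \<Longrightarrow> (\<lambda>p. a p + b p) \<in> zspan G"
| zspan_neg: "a \<in> zspan G \<Longrightarrow> (\<lambda>p. - a p) \<in> zspan G"

text \<open>Relations defining M (x)_R N (M a right R-module via actM, N a left R-module via actN)
 as a quotient of the free abelian group on M x N.\<close>
definition tensor_rels ::
  "'m set \<Rightarrow> ('m \<Rightarrow> 'm \<Rightarrow> 'm) \<Rightarrow> 'n set \<Rightarrow> ('n \<Rightarrow> 'n \<Rightarrow> 'n) \<Rightarrow> 'r set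
     \<Rightarrow> ('m \<Rightarrow> 'r \<Rightarrow> 'm) \<Rightarrow> ('r \<Rightarrow> 'n \<Rightarrow> 'n) \<Rightarrow> ('m \<times> 'n \<Rightarrow> int) set" where
  "tensor_rels M addM N addN R actM actN =
     zspan ({\<lambda>p. fsing (addM m1 m2, n) p - fsing (m1, n) p - fsing (m2, n) p | m1 m2 n. m1 \<in> M \<and> m2 \<in> M \<and> n \<in> N}
          \<union> {\<lambda>p. fsing (m, addN n1 n2) p - fsing (m, n1) p - fsing (m, n2) p | m n1 n2. m \<in> M \<and> n1 \<in> N \<and> n2 \<in> N}
          \<union> {\<lambda>p. fsing (actM m r, n) p - fsing (m, actN r n) p | m r n. m \<in> M \<and> r \<in> R \<and> n \<in> N})"

definition zmul :: "int \<Rightarrow> 'c::ab_group_add \<Rightarrow> 'c" where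
  "zmul n x = (if 0 \<le> n then sum (\<lambda>_. x) {..<nat n} else - sum (\<lambda>_. x) {..<nat (- n)})"

text \<open>The canonical map C (x)_C' C -> C (x) H = C^I, x (x) y |-> sum x y_<0> (x) y_<1>,
 evaluated on a formal combination of pairs.\<close>
definition galois_can :: "('c::ab_group_add \<Rightarrow> 'c \<Rightarrow> 'c) \<Rightarrow> ('c \<Rightarrow> 'i \<Rightarrow> 'c) \<Rightarrow> ('c \<times> 'c \<Rightarrow> int) \<Rightarrow> 'i \<Rightarrow> 'c" where
  "galois_can mlt rho s = (\<lambda>i. \<Sum>p\<in>fsupp s. zmul (s p) (mlt (fst p) (rho (snd p) i)))"

text \<open>C' \<subseteq> C is H-Galois: the canonical map is bijective (surjective, and its kernel
 consists of the formal sums that vanish in C (x)_C' C).\<close>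
definition hopf_galois :: "('c::ab_group_add \<Rightarrow> 'c \<Rightarrow> 'c) \<Rightarrow> ('c \<Rightarrow> 'i \<Rightarrow> 'c) \<Rightarrow> 'c set \<Rightarrow> 'c set \<Rightarrow> bool" where
  "hopf_galois mlt rho C' C \<longleftrightarrow>
     (\<forall>z. (\<forall>i. z i \<in> C) \<longrightarrow> (\<exists>s. formal_on s (C \<times> C) \<and> galois_can mlt rho s = z)) \<and>
     (\<forall>s. formal_on s (C \<times> C) \<longrightarrow> galois_can mlt rho s = (\<lambda>_. 0)
          \<longrightarrow> s \<in> tensor_rels C (+) C (+) C' mlt mlt)"

definition rlinear :: "('c, 'd) ring_scheme \<Rightarrow> ('c, 'n, 'e) module_scheme \<Rightarrow> ('c, 'n, 'f) module_scheme \<Rightarrow> ('n \<Rightarrow> 'n) \<Rightarrow> bool" where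
  "rlinear R N1 N2 f \<longleftrightarrow> f \<in> carrier N1 \<rightarrow> carrier N2 \<and>
     (\<forall>x\<in>carrier N1. \<forall>y\<in>carrier N1. f (x \<oplus>\<^bsub>N1\<^esub> y) = f x \<oplus>\<^bsub>N2\<^esub> f y) \<and>
     (\<forall>r\<in>carrier R. \<forall>x\<in>carrier N1. f (r \<odot>\<^bsub>N1\<^esub> x) = r \<odot>\<^bsub>N2\<^esub> f x)"

text \<open>M (a subset of the carrier type of R, which is an R-module via multiplication of R)
 tensored with an R-module N.\<close>
definition tens_rels :: "'c ring \<Rightarrow> 'c set \<Rightarrow> ('c, 'n) module \<Rightarrow> ('c \<times> 'n \<Rightarrow> int) set" where
  "tens_rels R M N = tensor_rels M (add R) (carrier N) (add N) (carrier R) (mult R) (smult N)"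

definition fmap :: "('x \<Rightarrow> 'y) \<Rightarrow> ('x \<Rightarrow> int) \<Rightarrow> ('y \<Rightarrow> int)" where
  "fmap g s = (\<lambda>q. \<Sum>p\<in>{p\<in>fsupp s. g p = q}. s p)"

text \<open>Flatness is tested against all R-modules whose elements live in a type 'n; the type
 is a parameter, and a free type variable in a theorem ranges over all types, so a theorem
 asserting flat_over TYPE('n) for arbitrary 'n asserts flatness in the usual sense.
 Flat: tensoring with M preserves injectivity of R-linear maps.
 Faithfully flat: flat, and M (x)_R N = 0 implies N = 0.\<close>
definition flat_over :: "'n itself \<Rightarrow> 'c ring \<Rightarrow> 'c set \<Rightarrow> bool" where
  "flat_over _ R M \<longleftrightarrow>
     (\<forall>(N1 :: ('c, 'n) module) (N2 :: ('c, 'n) module) f.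
        module R N1 \<longrightarrow> module R N2 \<longrightarrow> rlinear R N1 N2 f \<longrightarrow> inj_on f (carrier N1) \<longrightarrow>
        (\<forall>s. formal_on s (M \<times> carrier N1) \<longrightarrow>
             fmap (\<lambda>(m, n). (m, f n)) s \<in> tens_rels R M N2 \<longrightarrow> s \<in> tens_rels R M N1))"

definition faithfully_flat_over :: "'n itself \<Rightarrow> 'c ring \<Rightarrow> 'c set \<Rightarrow> bool" where
  "faithfully_flat_over T R M \<longleftrightarrow> flat_over T R M \<and>
     (\<forall>N :: ('c, 'n) module. module R N \<longrightarrow>
        (\<forall>s. formal_on s (M \<times> carrier N) \<longrightarrow> s \<in> tens_rels R M N) \<longrightarrow> carrier N = {\<zero>\<^bsub>N\<^esub>})"

definition centrally_galois ::
  "'n itself \<Rightarrow> ('c::ab_group_add \<Rightarrow> 'c \<Rightarrow> 'c) \<Rightarrow> 'c \<Rightarrow> ('i \<Rightarrow> 'c) \<Rightarrow> ('c \<Rightarrow> 'i \<Rightarrow> 'c) \<Rightarrow> 'c set \<Rightarrow> 'c set \<Rightarrow> bool" where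
  "centrally_galois T mlt un1 unitc rho C' C \<longleftrightarrow>
     C' = coinv mlt unitc rho C \<and>
     (let Z = center mlt C; Z0 = coinv mlt unitc rho Z in
        (\<forall>z\<in>Z. \<forall>i. rho z i \<in> Z) \<and>
        hopf_galois mlt rho Z0 Z \<and>
        faithfully_flat_over T \<lparr>carrier = Z0, monoid.mult = mlt, one = un1, zero = 0, add = (+)\<rparr> Z)"

end

theory Submission
  imports Defs "HOL-Analysis.Cartesian_Space" "HOL-Library.Function_Algebras"
begin

text \<open>Since \<open>H\<close> is commutative of characteristic zero, the normalised character of its regular
  representation is an integral \<open>\<phi>\<close> with \<open>\<phi>(1) = 1\<close>; the form \<open>\<phi>(xy)\<close> is nondegenerate, so there
  is \<open>e\<close> with \<open>\<phi>(ex) = \<epsilon>(x)\<close>. Hence every comodule algebra \<open>C\<close> has a trace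
  \<open>t(c) = c\<^sub>0 \<phi>(c\<^sub>1)\<close> onto its coinvariants with \<open>t(1) = 1\<close>. The antipode shows that the centre of
  \<open>C\<close> is a subcomodule. If the canonical map of some central subcomodule algebra reaches \<open>1 \<otimes> e\<close>,
  say from \<open>\<Sum> x\<^sub>j \<otimes> y\<^sub>j\<close>, then \<open>c = \<Sum> x\<^sub>j t(y\<^sub>j c)\<close> for all \<open>c\<close>: these are dual bases of the
  centre over its coinvariants. They give flatness, injectivity of the canonical map, and, together
  with \<open>t(1) = 1\<close>, faithful flatness. In the Ore extension the constants from
  \<open>A\<^sup>\<sigma> \<inter> A\<^sup>\<delta> \<inter> Z(A)\<close> are central and supply such elements.\<close>

section \<open>Commutative Hopf algebras in characteristic zero\<close>

text \<open>The obstacle is that the centre of T is not known explicitly: it contains the constants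
  from A^sigma \<inter> A^delta \<inter> Z(A) but may be larger, so the Galois property cannot
  simply be carried over from that algebra. What does carry over are preimages of the elements 1
  \<otimes> h, and dual bases built from them serve every central c at once: sum_j x_j t(y_j c) =
  sum_j x_j y_j0 c_0 phi(y_j1 c_1) = c_0 phi(e c_1) = c_0 eps(c_1) = c. The model for phi and e is
  the algebra of functions on a finite group G. There the trace of multiplication by f is the sum of
  the values of f, so phi is the mean over G, e is |G| times the indicator of the identity, and t is
  averaging. Division by dim H is where characteristic zero enters. Commutativity of H serves two
  main purposes: it makes traces of matrices over H invariant under conjugation, and it makes rho
  multiplicative for the opposite product, on which the centre argument rests.\<close>

locale k_alg = vector_space sc for sc :: "'k::field \<Rightarrow> 'c::ab_group_add \<Rightarrow> 'c" +
  fixes mlt :: "'c \<Rightarrow> 'c \<Rightarrow> 'c" and un1 :: 'c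
  assumes mlt_add_left: "mlt (x + y) z = mlt x z + mlt y z"
    and mlt_add_right: "mlt x (y + z) = mlt x y + mlt x z"
    and mlt_assoc: "mlt (mlt x y) z = mlt x (mlt y z)"
    and mlt_one_left [simp]: "mlt un1 x = x"
    and mlt_one_right [simp]: "mlt x un1 = x"
    and mlt_sc_left: "mlt (sc c x) y = sc c (mlt x y)"
    and mlt_sc_right: "mlt x (sc c y) = sc c (mlt x y)"
begin

lemma mlt_zero [simp]: "mlt 0 x = 0" "mlt x 0 = 0"
  using mlt_add_left[of 0 0 x] mlt_add_right[of x 0 0] by simp_all

lemma mlt_minus: "mlt (- x) y = - mlt x y" "mlt x (- y) = - mlt x y"
  using mlt_add_left[of x "- x" y] mlt_add_right[of x y "- y"]
  by (simp_all add: eq_neg_iff_add_eq_0 add.commute)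

lemma mlt_sum_left: "mlt (\<Sum>i\<in>I. f i) y = (\<Sum>i\<in>I. mlt (f i) y)"
  by (induction I rule: infinite_finite_induct) (simp_all add: mlt_add_left)

lemma mlt_sum_right: "mlt y (\<Sum>i\<in>I. f i) = (\<Sum>i\<in>I. mlt y (f i))"
  by (induction I rule: infinite_finite_induct) (simp_all add: mlt_add_right)

end

section \<open>Coordinate vectors and structure constants of H\<close>

definition hsc :: "'k::field \<Rightarrow> ('i \<Rightarrow> 'k) \<Rightarrow> 'i \<Rightarrow> 'k" where
  "hsc c x = (\<lambda>i. c * x i)"

lemma sum_delta_times:
  fixes f :: "'i::finite \<Rightarrow> 'k::comm_ring_1"
  shows "(\<Sum>i\<in>UNIV. (if i = a then 1 else 0) * f i) = f a"
    "(\<Sum>i\<in>UNIV. f i * (if i = a then 1 else 0)) = f a"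
    "(\<Sum>i\<in>UNIV. (if a = i then 1 else 0) * f i) = f a"
    "(\<Sum>i\<in>UNIV. f i * (if a = i then 1 else 0)) = f a"
  by (simp_all add: if_distrib[of "\<lambda>x. x * _"] if_distrib[of "\<lambda>x. _ * x"] cong: if_cong)

lemma (in k_alg) sc_delta:
  "sc c (sc (if P then 1 else 0) x) = (if P then sc c x else 0)"
  by simp

lemma (in k_alg) sum_sc_delta:
  fixes f :: "'i::finite \<Rightarrow> 'c"
  shows "(\<Sum>i\<in>UNIV. sc (if i = a then 1 else 0) (f i)) = f a"
    "(\<Sum>i\<in>UNIV. sc (if a = i then 1 else 0) (f i)) = f a"
  by (simp_all add: if_distrib[of "\<lambda>x. sc x _"] cong: if_cong)

lemma sum_hbasis:
  fixes f :: "'i::finite \<Rightarrow> 'k::field"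
  shows "(\<Sum>i\<in>UNIV. hbasis a i * f i) = f a"
  unfolding hbasis_def by (rule sum_delta_times)

lemma sum_fun_apply: "(\<Sum>i\<in>I. f i) k = (\<Sum>i\<in>I. f i k)"
  by (induction I rule: infinite_finite_induct) simp_all

lemma hmul_hbasis: "hmul mu (hbasis a) (hbasis b) k = mu a b k"
  unfolding hmul_def
  by (simp add: mult.assoc sum_hbasis flip: sum_distrib_left)

lemma hmul_hbasis_right: "hmul mu x (hbasis b) k = (\<Sum>a\<in>UNIV. x a * mu a b k)"
  unfolding hmul_def
  by (simp add: mult.assoc sum_hbasis flip: sum_distrib_left)

lemma hmul_hbasis_left: "hmul mu (hbasis a) x k = (\<Sum>b\<in>UNIV. x b * mu a b k)"
  unfolding hmul_def
  by (simp add: mult.assoc sum_hbasis flip: sum_distrib_left)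

lemma hcomul_hbasis: "hcomul com (hbasis x) (a, b) = com x a b"
  unfolding hcomul_def by (simp add: sum_hbasis)

lemma hantipode_hbasis: "hantipode ant (hbasis x) = ant x"
  unfolding hantipode_def by (simp add: sum_hbasis)

lemma hcounit_hbasis: "hcounit eps (hbasis x) = eps x"
  unfolding hcounit_def by (simp add: sum_hbasis)

lemma hfun_expand:
  fixes x :: "'i::finite \<Rightarrow> 'k::field"
  shows "x = (\<Sum>a\<in>UNIV. hsc (x a) (hbasis a))"
  by (rule ext) (simp add: sum_fun_apply hsc_def hbasis_def sum_delta_times)

locale comm_hopf =
  fixes mu :: "'i::finite \<Rightarrow> 'i \<Rightarrow> 'i \<Rightarrow> 'k::field_char_0"
    and un :: "'i \<Rightarrow> 'k" and com :: "'i \<Rightarrow> 'i \<Rightarrow> 'i \<Rightarrow> 'k"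
    and eps :: "'i \<Rightarrow> 'k" and ant :: "'i \<Rightarrow> 'i \<Rightarrow> 'k"
  assumes comm_hopf: "commutative_hopf_algebra mu un com eps ant"
begin

lemma hopf: "hopf_algebra mu un com eps ant"
  using comm_hopf by (simp add: commutative_hopf_algebra_def)

lemma hmul_commute: "hmul mu x y = hmul mu y x"
  using comm_hopf by (simp add: commutative_hopf_algebra_def)

lemma mu_commute: "mu i j k = mu j i k"
  using fun_cong[OF hmul_commute[of "hbasis i" "hbasis j"], of k] by (simp add: hmul_hbasis)

sublocale H: k_alg hsc "hmul mu" un
proof unfold_locales
  show "hmul mu (hmul mu x y) z = hmul mu x (hmul mu y z)" for x y z
    using hopf unfolding hopf_algebra_def by simp
  show "hmul mu un x = x" "hmul mu x un = x" for x
    using hopf unfolding hopf_algebra_def by simp_all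
qed (auto simp: hsc_def fun_eq_iff hmul_def algebra_simps sum.distrib sum_distrib_left)

text \<open>Reduces products with S(x) to basis elements, the form in which the antipode axioms are
  available.\<close>

lemma hmul_hantipode_sum: "hmul mu (hantipode ant x) y = 
  (\<Sum>a\<in>UNIV. \<Sum>b\<in>UNIV. hsc (x a * y b) (hmul mu (ant a) (hbasis b)))"
proof -
  have "hantipode ant x = (\<Sum>a\<in>UNIV. hsc (x a) (ant a))"
    by (rule ext) (simp add: hantipode_def sum_fun_apply hsc_def)
  then have "hmul mu (hantipode ant x) y = 
    hmul mu (\<Sum>a\<in>UNIV. hsc (x a) (ant a)) (\<Sum>b\<in>UNIV. hsc (y b) (hbasis b))"
    using hfun_expand[of y] by simp
  then show ?thesis
    by (subst sum.swap) (simp only: H.mlt_sum_left H.mlt_sum_right H.mlt_sc_left H.mlt_sc_right H.scale_sum_right H.scale_scale mult.commute)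
qed

lemma coassoc: "(\<Sum>i\<in>UNIV. com x i c * com i a b) = (\<Sum>j\<in>UNIV. com x a j * com j b c)"
proof -
  have "\<forall>x a b c. (\<Sum>i\<in>UNIV. hcomul com x (i, c) * com i a b)
              = (\<Sum>j\<in>UNIV. hcomul com x (a, j) * com j b c)"
    using hopf unfolding hopf_algebra_def by blast
  from this[rule_format, of "hbasis x" c a b] show ?thesis by (simp add: hcomul_hbasis)
qed

lemma counit_left: "(\<Sum>a\<in>UNIV. eps a * com x a b) = (if x = b then 1 else 0)"
proof -
  have "\<forall>x. (\<lambda>b. \<Sum>a\<in>UNIV. eps a * hcomul com x (a, b)) = x"
    using hopf unfolding hopf_algebra_def by blast
  from fun_cong[OF this[rule_format, of "hbasis x"], of b] show ?thesis
    by (simp add: hcomul_hbasis) (auto simp: hbasis_def)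
qed

lemma counit_right: "(\<Sum>b\<in>UNIV. com x a b * eps b) = (if x = a then 1 else 0)"
proof -
  have "\<forall>x. (\<lambda>a. \<Sum>b\<in>UNIV. hcomul com x (a, b) * eps b) = x"
    using hopf unfolding hopf_algebra_def by blast
  from fun_cong[OF this[rule_format, of "hbasis x"], of a] show ?thesis
    by (simp add: hcomul_hbasis) (auto simp: hbasis_def)
qed

lemma antipode_left: "(\<Sum>a\<in>UNIV. \<Sum>b\<in>UNIV. hsc (com x a b) (hmul mu (ant a) (hbasis b))) = hsc (eps x) un"
proof -
  have "\<forall>x. (\<lambda>k. \<Sum>a\<in>UNIV. \<Sum>b\<in>UNIV. hcomul com x (a, b) *
               hmul mu (hantipode ant (hbasis a)) (hbasis b) k) = (\<lambda>k. hcounit eps x * un k)"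
    using hopf unfolding hopf_algebra_def by blast
  from this[rule_format, of "hbasis x"] show ?thesis
    by (simp add: fun_eq_iff sum_fun_apply hsc_def hcomul_hbasis hantipode_hbasis hcounit_hbasis)
qed

lemma antipode_right: "(\<Sum>a\<in>UNIV. \<Sum>b\<in>UNIV. hsc (com x a b) (hmul mu (hbasis a) (ant b))) = hsc (eps x) un"
proof -
  have "\<forall>x. (\<lambda>k. \<Sum>a\<in>UNIV. \<Sum>b\<in>UNIV. hcomul com x (a, b) *
               hmul mu (hbasis a) (hantipode ant (hbasis b)) k) = (\<lambda>k. hcounit eps x * un k)"
    using hopf unfolding hopf_algebra_def by blast
  from this[rule_format, of "hbasis x"] show ?thesis
    by (simp add: fun_eq_iff sum_fun_apply hsc_def hcomul_hbasis hantipode_hbasis hcounit_hbasis)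
qed

text \<open>Writing Delta(e_x) = sum_b \<open>comatrix x b\<close> \<otimes> e_b turns the
  comultiplication into a square matrix C over H. Coassociativity says Delta(C_xc) = sum_b C_xb
  \<otimes> C_bc, so applying S entrywise gives the inverse matrix, and identities in H become
  matrix algebra over a commutative ring.\<close>

definition comatrix :: "'i \<Rightarrow> 'i \<Rightarrow> 'i \<Rightarrow> 'k" where "comatrix x b = (\<lambda>a. com x a b)"
definition comatrix_antipode :: "'i \<Rightarrow> 'i \<Rightarrow> 'i \<Rightarrow> 'k" where "comatrix_antipode x b = hantipode ant (comatrix x b)"

text \<open>With \<open>g a b\<close> equal to S(e_a) e_b or to e_a S(e_b), one computation serves
  both inverse identities: coassociativity turns the matrix product into an antipode axiom applied
  to C_xc, whose counit is the Kronecker delta.\<close>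

lemma comatrix_cancel:
  assumes "\<And>x. (\<Sum>a\<in>UNIV. \<Sum>b\<in>UNIV. hsc (com x a b) (g a b)) = hsc (eps x) un"
  shows "(\<Sum>b\<in>UNIV. \<Sum>a\<in>UNIV. \<Sum>d\<in>UNIV. hsc (com x a b * com b d c) (g a d)) = hsc (if x = c then 1 else 0) un"
proof -
  have "(\<Sum>b\<in>UNIV. \<Sum>a\<in>UNIV. \<Sum>d\<in>UNIV. hsc (com x a b * com b d c) (g a d)) = 
      (\<Sum>a\<in>UNIV. \<Sum>d\<in>UNIV. \<Sum>b\<in>UNIV. hsc (com x a b * com b d c) (g a d))"
    by (subst sum.swap, intro sum.cong refl sum.swap)
  also have "\<dots> = (\<Sum>a\<in>UNIV. \<Sum>d\<in>UNIV. hsc (\<Sum>i\<in>UNIV. com x i c * com i a d) (g a d))"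
    by (simp only: coassoc H.scale_sum_left)
  also have "\<dots> = (\<Sum>a\<in>UNIV. \<Sum>d\<in>UNIV. \<Sum>i\<in>UNIV. hsc (com x i c) (hsc (com i a d) (g a d)))"
    by (simp only: H.scale_sum_left H.scale_scale)
  also have "\<dots> = (\<Sum>a\<in>UNIV. \<Sum>i\<in>UNIV. \<Sum>d\<in>UNIV. hsc (com x i c) (hsc (com i a d) (g a d)))"
    by (intro sum.cong refl sum.swap)
  also have "\<dots> = (\<Sum>i\<in>UNIV. \<Sum>a\<in>UNIV. \<Sum>d\<in>UNIV. hsc (com x i c) (hsc (com i a d) (g a d)))"
    by (rule sum.swap)
  also have "\<dots> = (\<Sum>i\<in>UNIV. hsc (com x i c) (hsc (eps i) un))"
    by (simp only: assms flip: H.scale_sum_right)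
  also have "\<dots> = hsc (\<Sum>i\<in>UNIV. eps i * com x i c) un"
    by (simp only: H.scale_sum_left H.scale_scale mult.commute)
  finally show ?thesis by (simp only: counit_left)
qed

lemma comatrix_antipode_left_inverse: "(\<Sum>b\<in>UNIV. hmul mu (comatrix_antipode x b) (comatrix b c)) = hsc (if x = c then 1 else 0) un"
proof -
  have "(\<Sum>b\<in>UNIV. hmul mu (comatrix_antipode x b) (comatrix b c)) =
     (\<Sum>b\<in>UNIV. \<Sum>a\<in>UNIV. \<Sum>d\<in>UNIV. hsc (com x a b * com b d c) (hmul mu (ant a) (hbasis d)))"
    by (simp add: comatrix_antipode_def hmul_hantipode_sum comatrix_def)
  then show ?thesis using comatrix_cancel[OF antipode_left] by simp
qed

lemma comatrix_antipode_inverse: "(\<Sum>b\<in>UNIV. hmul mu (comatrix x b) (comatrix_antipode b c)) = hsc (if x = c then 1 else 0) un"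
proof -
  have "hmul mu (comatrix x b) (comatrix_antipode b c) = (\<Sum>a\<in>UNIV. \<Sum>d\<in>UNIV. hsc (com x a b * com b d c) (hmul mu (hbasis a) (ant d)))" for b
  proof -
    \<comment> \<open>Commutativity moves the antipode to the left, where
      \<open>hmul_hantipode_sum\<close> applies.\<close>
    have "hmul mu (comatrix x b) (comatrix_antipode b c) = hmul mu (comatrix_antipode b c) (comatrix x b)"
      by (rule hmul_commute)
    also have "\<dots> = (\<Sum>d\<in>UNIV. \<Sum>a\<in>UNIV. hsc (com x a b * com b d c) (hmul mu (hbasis a) (ant d)))"
      by (simp only: comatrix_antipode_def hmul_hantipode_sum comatrix_def mult.commute hmul_commute[of "ant _"])
    finally show ?thesis by (subst sum.swap) simp
  qed
  then show ?thesis using comatrix_cancel[OF antipode_right] by simp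
qed

text \<open>Compares the coefficients of e_c in the second tensor factor of Delta(e_h e_x) =
  Delta(e_h) Delta(e_x).\<close>

lemma comatrix_mult:
  "(\<Sum>y\<in>UNIV. hsc (mu h x y) (comatrix y c)) = (\<Sum>g\<in>UNIV. \<Sum>b\<in>UNIV. hsc (mu g b c) (hmul mu (comatrix h g) (comatrix x b)))"
proof
  fix a
  have "\<forall>x y. hcomul com (hmul mu x y) = t2mul mu (hcomul com x) (hcomul com y)"
    using hopf unfolding hopf_algebra_def by blast
  from fun_cong[OF this[rule_format, of "hbasis h" "hbasis x"], of "(a, c)"]
  have "(\<Sum>y\<in>UNIV. mu h x y * com y a c) = 
    (\<Sum>i\<in>UNIV. \<Sum>g\<in>UNIV. \<Sum>j\<in>UNIV. \<Sum>b\<in>UNIV. com h i g * com x j b * mu i j a * mu g b c)"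
    by (simp add: t2mul_def hcomul_hbasis) (simp add: hcomul_def hmul_hbasis)
  also have "\<dots> = (\<Sum>g\<in>UNIV. \<Sum>i\<in>UNIV. \<Sum>j\<in>UNIV. \<Sum>b\<in>UNIV. com h i g * com x j b * mu i j a * mu g b c)"
    by (rule sum.swap)
  also have "\<dots> = (\<Sum>g\<in>UNIV. \<Sum>i\<in>UNIV. \<Sum>b\<in>UNIV. \<Sum>j\<in>UNIV. com h i g * com x j b * mu i j a * mu g b c)"
    by (intro sum.cong refl sum.swap)
  also have "\<dots> = (\<Sum>g\<in>UNIV. \<Sum>b\<in>UNIV. \<Sum>i\<in>UNIV. \<Sum>j\<in>UNIV. com h i g * com x j b * mu i j a * mu g b c)"
    by (intro sum.cong refl sum.swap)
  finally show "(\<Sum>y\<in>UNIV. hsc (mu h x y) (comatrix y c)) a = (\<Sum>g\<in>UNIV. \<Sum>b\<in>UNIV. hsc (mu g b c) (hmul mu (comatrix h g) (comatrix x b))) a"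
    by (simp add: sum_fun_apply hsc_def comatrix_def hmul_def sum_distrib_left mult_ac)
qed

text \<open>The character of the regular representation is an integral: multiplication by \<open>h\<close> on the
  first factor of \<open>H \<otimes> H\<close> and the diagonal action of \<open>h\<close> are conjugate via \<open>x \<otimes> y \<mapsto> x\<^sub>1 \<otimes> x\<^sub>2 y\<close>,
  so their traces over the commutative ring \<open>H\<close> agree.\<close>

definition regular_trace :: "'i \<Rightarrow> 'k" where
  "regular_trace h = (\<Sum>x\<in>UNIV. mu h x x)"

lemma regular_trace_integral: "hsc (regular_trace h) un = (\<Sum>g\<in>UNIV. hsc (regular_trace g) (comatrix h g))"
proof -
  have "hsc (regular_trace h) un = (\<Sum>x\<in>UNIV. \<Sum>y\<in>UNIV. hsc (mu h x y) (hsc (if y = x then 1 else 0) un))"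
    by (simp only: regular_trace_def H.scale_sum_left H.sc_delta) simp
  \<comment> \<open>The Kronecker delta is opened as the entry (y, x) of C S(C); this is the
    conjugation by C.\<close>
  also have "\<dots> = (\<Sum>x\<in>UNIV. \<Sum>y\<in>UNIV. \<Sum>c\<in>UNIV. hsc (mu h x y) (hmul mu (comatrix y c) (comatrix_antipode c x)))"
    by (simp only: comatrix_antipode_inverse[symmetric] H.scale_sum_right)
  also have "\<dots> = (\<Sum>x\<in>UNIV. \<Sum>c\<in>UNIV. \<Sum>y\<in>UNIV. hsc (mu h x y) (hmul mu (comatrix y c) (comatrix_antipode c x)))"
    by (intro sum.cong refl sum.swap)
  also have "\<dots> = (\<Sum>x\<in>UNIV. \<Sum>c\<in>UNIV. hmul mu (\<Sum>y\<in>UNIV. hsc (mu h x y) (comatrix y c)) (comatrix_antipode c x))"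
    by (simp only: H.mlt_sum_left H.mlt_sc_left)
  \<comment> \<open>Commutativity of H brings S(C) in front of C, as in the cyclic invariance of a
    trace; the sum over x then cancels the two.\<close>
  also have "\<dots> = (\<Sum>x\<in>UNIV. \<Sum>c\<in>UNIV. \<Sum>g\<in>UNIV. \<Sum>b\<in>UNIV. hsc (mu g b c) (hmul mu (comatrix h g) (hmul mu (comatrix_antipode c x) (comatrix x b))))"
    by (simp only: comatrix_mult H.mlt_sum_left H.mlt_sc_left H.mlt_assoc hmul_commute[of "comatrix_antipode _ _"])
  also have "\<dots> = (\<Sum>c\<in>UNIV. \<Sum>x\<in>UNIV. \<Sum>g\<in>UNIV. \<Sum>b\<in>UNIV. hsc (mu g b c) (hmul mu (comatrix h g) (hmul mu (comatrix_antipode c x) (comatrix x b))))"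
    by (rule sum.swap)
  also have "\<dots> = (\<Sum>c\<in>UNIV. \<Sum>g\<in>UNIV. \<Sum>x\<in>UNIV. \<Sum>b\<in>UNIV. hsc (mu g b c) (hmul mu (comatrix h g) (hmul mu (comatrix_antipode c x) (comatrix x b))))"
    by (intro sum.cong refl sum.swap)
  also have "\<dots> = (\<Sum>c\<in>UNIV. \<Sum>g\<in>UNIV. \<Sum>b\<in>UNIV. \<Sum>x\<in>UNIV. hsc (mu g b c) (hmul mu (comatrix h g) (hmul mu (comatrix_antipode c x) (comatrix x b))))"
    by (intro sum.cong refl sum.swap)
  also have "\<dots> = (\<Sum>c\<in>UNIV. \<Sum>g\<in>UNIV. \<Sum>b\<in>UNIV. hsc (mu g b c) (hmul mu (comatrix h g) (hsc (if c = b then 1 else 0) un)))"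
    by (simp only: comatrix_antipode_left_inverse H.mlt_sum_right[symmetric] H.scale_sum_right[symmetric])
  also have "\<dots> = (\<Sum>c\<in>UNIV. \<Sum>g\<in>UNIV. hsc (mu g c c) (comatrix h g))"
    by (simp only: H.mlt_sc_right H.mlt_one_right H.sc_delta) simp
  also have "\<dots> = (\<Sum>g\<in>UNIV. hsc (regular_trace g) (comatrix h g))"
    by (subst sum.swap) (simp only: regular_trace_def H.scale_sum_left)
  finally show ?thesis .
qed

text \<open>The unit acts as the identity, whose trace is dim H, an invertible number in
  characteristic zero.\<close>

lemma regular_trace_un: "(\<Sum>i\<in>UNIV. un i * regular_trace i) = of_nat CARD('i)"
proof -
  have "(\<Sum>i\<in>UNIV. un i * mu i x x) = 1" for x
    using fun_cong[OF H.mlt_one_left[of "hbasis x"], of x]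
    unfolding hmul_hbasis_right by (simp add: hbasis_def)
  then show ?thesis
    by (simp add: regular_trace_def sum_distrib_left sum.swap[of "\<lambda>i x. un i * mu i x x"])
qed

section \<open>The normalised integral and its bilinear form\<close>

definition phi :: "'i \<Rightarrow> 'k" where "phi i = regular_trace i / of_nat CARD('i)"

lemma phi_un: "(\<Sum>i\<in>UNIV. un i * phi i) = 1"
  using regular_trace_un by (simp add: phi_def flip: sum_divide_distrib)

lemma phi_integral: "hsc (phi h) un = (\<Sum>g\<in>UNIV. hsc (phi g) (comatrix h g))"
proof -
  have "hsc (phi i) v = hsc (1 / of_nat CARD('i)) (hsc (regular_trace i) v)" for i and v :: "'i \<Rightarrow> 'k"
    by (simp add: phi_def hsc_def)
  then show ?thesis
    by (simp only: regular_trace_integral H.scale_sum_right)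
qed

lemma phi_integral_coord: "(\<Sum>g\<in>UNIV. com h a g * phi g) = phi h * un a"
  using fun_cong[OF phi_integral[of h], of a]
  by (simp add: hsc_def sum_fun_apply comatrix_def mult.commute)

definition phi_form :: "'i \<Rightarrow> 'i \<Rightarrow> 'k" where
  "phi_form x y = (\<Sum>k\<in>UNIV. mu x y k * phi k)"

lemma phi_form_commute: "phi_form x y = phi_form y x"
  by (simp add: phi_form_def mu_commute)

text \<open>The integral property of phi at the product e_k e_b, whose comultiplication is opened by
  \<open>comatrix_mult\<close>.\<close>

lemma phi_form_comatrix:
  "hsc (phi_form k b) un = (\<Sum>g\<in>UNIV. \<Sum>d\<in>UNIV. hsc (phi_form g d) (hmul mu (comatrix k g) (comatrix b d)))"
proof -
  have "hsc (phi_form k b) un = (\<Sum>y\<in>UNIV. \<Sum>c\<in>UNIV. hsc (mu k b y) (hsc (phi c) (comatrix y c)))"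
    by (simp only: phi_form_def H.scale_sum_left phi_integral H.scale_sum_right flip: H.scale_scale)
  also have "\<dots> = (\<Sum>c\<in>UNIV. \<Sum>y\<in>UNIV. hsc (mu k b y) (hsc (phi c) (comatrix y c)))"
    by (rule sum.swap)
  also have "\<dots> = (\<Sum>c\<in>UNIV. hsc (phi c) (\<Sum>y\<in>UNIV. hsc (mu k b y) (comatrix y c)))"
    by (simp only: H.scale_sum_right H.scale_scale mult.commute)
  also have "\<dots> = (\<Sum>c\<in>UNIV. \<Sum>g\<in>UNIV. \<Sum>d\<in>UNIV. hsc (mu g d c * phi c) (hmul mu (comatrix k g) (comatrix b d)))"
    by (simp only: comatrix_mult H.scale_sum_right H.scale_scale mult.commute)
  also have "\<dots> = (\<Sum>g\<in>UNIV. \<Sum>c\<in>UNIV. \<Sum>d\<in>UNIV. hsc (mu g d c * phi c) (hmul mu (comatrix k g) (comatrix b d)))"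
    by (rule sum.swap)
  also have "\<dots> = (\<Sum>g\<in>UNIV. \<Sum>d\<in>UNIV. \<Sum>c\<in>UNIV. hsc (mu g d c * phi c) (hmul mu (comatrix k g) (comatrix b d)))"
    by (intro sum.cong refl sum.swap)
  finally show ?thesis by (simp only: phi_form_def H.scale_sum_left)
qed

text \<open>In Sweedler notation S(x_1) phi(k x_2) = k_1 phi(k_2 x): insert the integral property
  and cancel S(x_1) against x_2. This moves a coproduct from one argument of the form to the
  other.\<close>

lemma phi_form_antipode:
  "(\<Sum>b\<in>UNIV. hsc (phi_form k b) (comatrix_antipode x b)) = (\<Sum>g\<in>UNIV. hsc (phi_form g x) (comatrix k g))"
proof -
  have "(\<Sum>b\<in>UNIV. hsc (phi_form k b) (comatrix_antipode x b)) = (\<Sum>b\<in>UNIV. hmul mu (comatrix_antipode x b) (hsc (phi_form k b) un))"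
    by (simp add: H.mlt_sc_right)
  also have "\<dots> = (\<Sum>b\<in>UNIV. \<Sum>g\<in>UNIV. \<Sum>d\<in>UNIV. hsc (phi_form g d) (hmul mu (hmul mu (comatrix_antipode x b) (comatrix b d)) (comatrix k g)))"
    by (simp only: phi_form_comatrix H.mlt_sc_right H.mlt_sum_right H.mlt_assoc hmul_commute[of "comatrix k _"])
  also have "\<dots> = (\<Sum>g\<in>UNIV. \<Sum>b\<in>UNIV. \<Sum>d\<in>UNIV. hsc (phi_form g d) (hmul mu (hmul mu (comatrix_antipode x b) (comatrix b d)) (comatrix k g)))"
    by (rule sum.swap)
  also have "\<dots> = (\<Sum>g\<in>UNIV. \<Sum>d\<in>UNIV. \<Sum>b\<in>UNIV. hsc (phi_form g d) (hmul mu (hmul mu (comatrix_antipode x b) (comatrix b d)) (comatrix k g)))"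
    by (intro sum.cong refl sum.swap)
  also have "\<dots> = (\<Sum>g\<in>UNIV. \<Sum>d\<in>UNIV. hsc (phi_form g d) (hmul mu (hsc (if x = d then 1 else 0) un) (comatrix k g)))"
    by (simp only: H.mlt_sum_left[symmetric] H.scale_sum_right[symmetric] comatrix_antipode_left_inverse)
  also have "\<dots> = (\<Sum>g\<in>UNIV. hsc (phi_form g x) (comatrix k g))"
    by (simp only: H.mlt_sc_left H.mlt_one_left H.sc_delta) simp
  finally show ?thesis .
qed

text \<open>Evaluating phi on S(k_1) k_2 = eps(k) 1, with phi(1) = 1, expresses the counit through
  the form.\<close>

lemma eps_phi_form:
  "eps k = (\<Sum>a\<in>UNIV. \<Sum>b\<in>UNIV. \<Sum>q\<in>UNIV. com k a b * ant a q * phi_form q b)"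
proof -
  have "hmul mu (ant a) (hbasis b) i = (\<Sum>q\<in>UNIV. ant a q * mu q b i)" for a b i
    by (rule hmul_hbasis_right)
  then have *: "(\<Sum>a\<in>UNIV. \<Sum>b\<in>UNIV. com k a b * (\<Sum>q\<in>UNIV. ant a q * mu q b i)) = eps k * un i" for i
    using fun_cong[OF antipode_left[of k], of i] by (simp add: hsc_def sum_fun_apply)
  have "eps k = (\<Sum>i\<in>UNIV. (eps k * un i) * phi i)"
    using phi_un by (simp add: mult.assoc flip: sum_distrib_left)
  also have "\<dots> = (\<Sum>i\<in>UNIV. \<Sum>a\<in>UNIV. \<Sum>b\<in>UNIV. \<Sum>q\<in>UNIV. com k a b * ant a q * (mu q b i * phi i))"
    by (simp only: *[symmetric] sum_distrib_left sum_distrib_right mult_ac)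
  also have "\<dots> = (\<Sum>a\<in>UNIV. \<Sum>i\<in>UNIV. \<Sum>b\<in>UNIV. \<Sum>q\<in>UNIV. com k a b * ant a q * (mu q b i * phi i))"
    by (rule sum.swap)
  also have "\<dots> = (\<Sum>a\<in>UNIV. \<Sum>b\<in>UNIV. \<Sum>i\<in>UNIV. \<Sum>q\<in>UNIV. com k a b * ant a q * (mu q b i * phi i))"
    by (intro sum.cong refl sum.swap)
  also have "\<dots> = (\<Sum>a\<in>UNIV. \<Sum>b\<in>UNIV. \<Sum>q\<in>UNIV. \<Sum>i\<in>UNIV. com k a b * ant a q * (mu q b i * phi i))"
    by (intro sum.cong refl sum.swap)
  finally show ?thesis by (simp only: phi_form_def sum_distrib_left)
qed

text \<open>By \<open>phi_form_antipode\<close>, h_1 phi(h_2 x) = S(x_1) phi(h x_2), which vanishes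
  for h in the radical. Hence the second tensor factors of Delta(h) lie in the radical
  again.\<close>

lemma phi_radical_coideal:
  assumes "\<And>x. (\<Sum>k\<in>UNIV. h k * phi_form k x) = 0"
  shows "(\<Sum>g\<in>UNIV. (\<Sum>k\<in>UNIV. h k * com k a g) * phi_form g x) = 0"
proof -
  have "(\<Sum>g\<in>UNIV. (\<Sum>k\<in>UNIV. h k * com k a g) * phi_form g x) = 
    (\<Sum>g\<in>UNIV. \<Sum>k\<in>UNIV. h k * (phi_form g x * comatrix k g a))"
    by (simp add: comatrix_def sum_distrib_left mult_ac)
  also have "\<dots> = (\<Sum>k\<in>UNIV. h k * (\<Sum>g\<in>UNIV. phi_form g x * comatrix k g a))"
    by (subst sum.swap) (simp only: sum_distrib_left)
  also have "\<dots> = (\<Sum>k\<in>UNIV. h k * (\<Sum>b\<in>UNIV. phi_form k b * comatrix_antipode x b a))"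
    using fun_cong[OF phi_form_antipode, of _ x a] by (simp add: hsc_def sum_fun_apply)
  also have "\<dots> = (\<Sum>k\<in>UNIV. \<Sum>b\<in>UNIV. (h k * phi_form k b) * comatrix_antipode x b a)"
    by (simp only: sum_distrib_left mult.assoc)
  also have "\<dots> = (\<Sum>b\<in>UNIV. (\<Sum>k\<in>UNIV. h k * phi_form k b) * comatrix_antipode x b a)"
    by (subst sum.swap) (simp only: sum_distrib_right)
  finally show ?thesis by (simp add: assms)
qed

text \<open>Here eps(h) = phi(S(h_1) h_2), and h_2 lies in the radical.\<close>

lemma eps_phi_radical:
  assumes "\<And>x. (\<Sum>k\<in>UNIV. h k * phi_form k x) = 0"
  shows "(\<Sum>k\<in>UNIV. h k * eps k) = 0"
proof -
  have "(\<Sum>k\<in>UNIV. h k * eps k) =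
    (\<Sum>k\<in>UNIV. \<Sum>a\<in>UNIV. \<Sum>b\<in>UNIV. \<Sum>q\<in>UNIV. ant a q * (h k * com k a b * phi_form b q))"
    by (subst eps_phi_form) (simp only: sum_distrib_left mult_ac phi_form_commute)
  also have "\<dots> = (\<Sum>a\<in>UNIV. \<Sum>k\<in>UNIV. \<Sum>b\<in>UNIV. \<Sum>q\<in>UNIV. ant a q * (h k * com k a b * phi_form b q))"
    by (rule sum.swap)
  also have "\<dots> = (\<Sum>a\<in>UNIV. \<Sum>b\<in>UNIV. \<Sum>k\<in>UNIV. \<Sum>q\<in>UNIV. ant a q * (h k * com k a b * phi_form b q))"
    by (intro sum.cong refl sum.swap)
  also have "\<dots> = (\<Sum>a\<in>UNIV. \<Sum>b\<in>UNIV. \<Sum>q\<in>UNIV. \<Sum>k\<in>UNIV. ant a q * (h k * com k a b * phi_form b q))"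
    by (intro sum.cong refl sum.swap)
  also have "\<dots> = (\<Sum>a\<in>UNIV. \<Sum>q\<in>UNIV. \<Sum>b\<in>UNIV. \<Sum>k\<in>UNIV. ant a q * (h k * com k a b * phi_form b q))"
    by (intro sum.cong refl sum.swap)
  also have "\<dots> = (\<Sum>a\<in>UNIV. \<Sum>q\<in>UNIV. ant a q * (\<Sum>b\<in>UNIV. (\<Sum>k\<in>UNIV. h k * com k a b) * phi_form b q))"
    by (simp only: sum_distrib_left sum_distrib_right)
  finally show ?thesis by (simp add: phi_radical_coideal[OF assms])
qed

text \<open>The radical of the form is an ideal and a left coideal, and the antipode axiom shows that the
  counit vanishes on it; being a coideal, it is then zero.\<close>

lemma phi_form_nondegenerate:
  assumes "\<And>x. (\<Sum>k\<in>UNIV. h k * phi_form k x) = 0"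
  shows "h a = 0"
proof -
  have "0 = (\<Sum>g\<in>UNIV. (\<Sum>k\<in>UNIV. h k * com k a g) * eps g)"
    by (rule eps_phi_radical[symmetric]) (rule phi_radical_coideal[OF assms])
  also have "\<dots> = (\<Sum>k\<in>UNIV. \<Sum>g\<in>UNIV. h k * (com k a g * eps g))"
    by (subst sum.swap) (simp only: sum_distrib_right mult.assoc)
  also have "\<dots> = (\<Sum>k\<in>UNIV. h k * (\<Sum>g\<in>UNIV. com k a g * eps g))"
    by (simp only: sum_distrib_left)
  also have "\<dots> = h a" by (simp only: counit_right sum_delta_times)
  finally show ?thesis by simp
qed

text \<open>By a dimension count a nondegenerate form identifies H with its dual; e is the vector
  representing the counit. The type \<open>'k ^ 'i\<close> is chosen because it carries
  finite-dimensional linear algebra over an arbitrary field.\<close>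

lemma ex_dual_integral: "\<exists>e. \<forall>q. (\<Sum>p\<in>UNIV. e p * phi_form p q) = eps q"
proof -
  define f :: "'k ^ 'i \<Rightarrow> 'k ^ 'i" where "f v = (\<chi> q. \<Sum>p\<in>UNIV. v $ p * phi_form p q)" for v
  have lin: "Vector_Spaces.linear (*s) (*s) f"
    by (simp add: Vector_Spaces.linear_iff vec.vector_space_axioms)
      (simp add: f_def vec_eq_iff distrib_right sum.distrib sum_distrib_left mult.assoc)
  have "inj f"
    unfolding vec.linear_inj_iff_eq_0[OF lin]
  proof (intro allI impI)
    fix v assume "f v = 0"
    then have "(\<Sum>p\<in>UNIV. v $ p * phi_form p q) = 0" for q
      by (simp add: f_def vec_eq_iff)
    then show "v = 0"
      using phi_form_nondegenerate[of "\<lambda>k. v $ k"] unfolding vec_eq_iff zero_index by blast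
  qed
  then have "surj f" using vec.linear_inj_imp_surj[OF lin] by blast
  then obtain v where "f v = (\<chi> q. eps q)" by (metis surjD)
  then show ?thesis
    by (intro exI[of _ "\<lambda>p. v $ p"]) (simp add: f_def vec_eq_iff)
qed

end

section \<open>Formal sums and tensor products\<close>

lemma zspan_plus: "a \<in> zspan G \<Longrightarrow> b \<in> zspan G \<Longrightarrow> a + b \<in> zspan G"
  by (simp add: zspan_add plus_fun_def)

lemma zspan_uminus: "a \<in> zspan G \<Longrightarrow> - a \<in> zspan G"
  by (simp add: zspan_neg fun_Compl_def)

lemma zspan_0: "0 \<in> zspan G"
  using zspan_zero[of G] by (simp add: zero_fun_def)

lemma zspan_sum: "(\<And>j. j \<in> J \<Longrightarrow> f j \<in> zspan G) \<Longrightarrow> (\<Sum>j\<in>J. f j) \<in> zspan G"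
  by (induction J rule: infinite_finite_induct) (auto intro: zspan_plus zspan_0)

lemma zspan_induct [consumes 1, case_names zero gen plus uminus]:
  assumes "s \<in> zspan G" and "P 0" and "\<And>g. g \<in> G \<Longrightarrow> P g"
    and "\<And>a b. a \<in> zspan G \<Longrightarrow> b \<in> zspan G \<Longrightarrow> P a \<Longrightarrow> P b \<Longrightarrow> P (a + b)"
    and "\<And>a. a \<in> zspan G \<Longrightarrow> P a \<Longrightarrow> P (- a)"
  shows "P s"
  using assms(1)
proof induction
  case zspan_zero then show ?case using assms(2) by (simp add: zero_fun_def)
next
  case (zspan_gen g) then show ?case by (rule assms(3))
next
  case (zspan_add a b) then show ?case using assms(4)[of a b] by (simp add: plus_fun_def)
next
  case (zspan_neg a) then show ?case using assms(5)[of a] by (simp add: fun_Compl_def)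
qed

lemma fsupp_simps [simp]: "fsupp 0 = {}" "fsupp (fsing x) = {x}" "fsupp (- a) = fsupp a"
  by (auto simp: fsupp_def fsing_def)

lemma fsing_same [simp]: "fsing x x = 1"
  by (simp add: fsing_def)

lemma fsupp_plus: "fsupp (a + b) \<subseteq> fsupp a \<union> fsupp b"
  by (auto simp: fsupp_def)

lemma formal_zero [simp]: "formal_on 0 X"
  by (simp add: formal_on_def)

lemma formal_fsing: "x \<in> X \<Longrightarrow> formal_on (fsing x) X"
  by (simp add: formal_on_def)

lemma formal_plus: "formal_on a X \<Longrightarrow> formal_on b X \<Longrightarrow> formal_on (a + b) X"
  using fsupp_plus[of a b] finite_subset[OF fsupp_plus[of a b]] by (auto simp: formal_on_def)

lemma formal_uminus: "formal_on a X \<Longrightarrow> formal_on (- a) X"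
  by (simp add: formal_on_def)

lemma formal_minus: "formal_on a X \<Longrightarrow> formal_on b X \<Longrightarrow> formal_on (a - b) X"
  using formal_plus[of a X "- b"] by (simp add: formal_uminus)

lemma formal_sum: "(\<And>j. j \<in> J \<Longrightarrow> formal_on (f j) X) \<Longrightarrow> formal_on (\<Sum>j\<in>J. f j) X"
  by (induction J rule: infinite_finite_induct) (auto intro: formal_plus)

lemma zspan_multiple:
  assumes "g \<in> zspan G" shows "(\<lambda>p. n * g p) \<in> zspan G"
proof (induction n rule: int_induct[where k = 0])
  case base then show ?case by (simp add: zspan_zero)
next
  case (step1 i)
  then show ?case using zspan_add[OF step1(2) assms] by (simp add: distrib_right)
next
  case (step2 i)
  then show ?case using zspan_add[OF step2(2) zspan_neg[OF assms]] by (simp add: left_diff_distrib)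
qed

lemma formal_zspan:
  assumes "formal_on s X" shows "s \<in> zspan (fsing ` X)"
proof -
  have fin: "finite (fsupp s)" and sub: "fsupp s \<subseteq> X"
    using assms by (auto simp: formal_on_def)
  have eq: "s p = (\<Sum>x\<in>fsupp s. s x * fsing x p)" for p
    using fin by (auto simp: fsing_def if_distrib[of "\<lambda>z. _ * z"] fsupp_def cong: if_cong)
  have "(\<Sum>x\<in>A. (\<lambda>p. s x * fsing x p)) q = (\<Sum>x\<in>A. s x * fsing x q)" for A q
    by (induction A rule: infinite_finite_induct) simp_all
  then have s: "s = (\<Sum>x\<in>fsupp s. (\<lambda>p. s x * fsing x p))"
    by (intro ext trans[OF eq]) (rule sym)
  have "(\<Sum>x\<in>fsupp s. (\<lambda>p. s x * fsing x p)) \<in> zspan (fsing ` X)"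
    using sub by (intro zspan_sum zspan_multiple) (auto intro: zspan_gen)
  then show ?thesis by (subst s)
qed

lemma formal_of_zspan: "s \<in> zspan (fsing ` X) \<Longrightarrow> formal_on s X"
proof (induction rule: zspan_induct)
  case zero show ?case by (rule formal_zero)
next
  case (plus a b) show ?case by (rule formal_plus[OF plus(3,4)])
next
  case (uminus a) show ?case by (rule formal_uminus[OF uminus(2)])
next
  case (gen g)
  then obtain x where "x \<in> X" "g = fsing x" by (rule imageE)
  then show ?case by (simp only: formal_fsing)
qed

text \<open>Replaces reasoning about finite supports: an additive identity between formal sums need
  only be checked on a single generator.\<close>

lemma formal_induct [consumes 1, case_names zero fsing plus uminus]:
  assumes "formal_on s X" and "P 0" and "\<And>x. x \<in> X \<Longrightarrow> P (fsing x)"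
    and "\<And>a b. formal_on a X \<Longrightarrow> formal_on b X \<Longrightarrow> P a \<Longrightarrow> P b \<Longrightarrow> P (a + b)"
    and "\<And>a. formal_on a X \<Longrightarrow> P a \<Longrightarrow> P (- a)"
  shows "P s"
  using formal_zspan[OF assms(1)]
proof (induction rule: zspan_induct)
  case zero show ?case by (rule assms(2))
next
  case (plus a b) show ?case by (rule assms(4)[OF formal_of_zspan[OF plus(1)] formal_of_zspan[OF plus(2)] plus(3,4)])
next
  case (uminus a) show ?case by (rule assms(5)[OF formal_of_zspan[OF uminus(1)] uminus(2)])
next
  case (gen g)
  then obtain x where x: "x \<in> X" "g = fsing x" by (rule imageE)
  show ?case unfolding x(2) by (rule assms(3)[OF x(1)])
qed

text \<open>Writing integers as differences of naturals removes the sign split of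
  \<open>zmul\<close> from later arguments.\<close>

lemma zmul_diff: "zmul (int a - int b) x = (\<Sum>_<a. x) - (\<Sum>_<b. x)"
proof -
  have add: "(\<Sum>_<m + n. x) = (\<Sum>_<m. x) + (\<Sum>_<n. x)" for m n :: nat
    by (induction n) (simp_all add: add.assoc)
  show ?thesis
  proof (cases "b \<le> a")
    case True
    then have "(\<Sum>_<a. x) = (\<Sum>_<a - b. x) + (\<Sum>_<b. x)" using add[of "a - b" b] by simp
    with True show ?thesis by (simp add: zmul_def nat_diff_distrib)
  next
    case False
    then have "(\<Sum>_<b. x) = (\<Sum>_<b - a. x) + (\<Sum>_<a. x)" using add[of "b - a" a] by simp
    with False show ?thesis by (simp add: zmul_def nat_diff_distrib)
  qed
qed

lemma zmul_add: "zmul (m + n) x = zmul m x + zmul n x"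
proof -
  have add: "(\<Sum>_<m + n. x) = (\<Sum>_<m. x) + (\<Sum>_<n. x)" for m n :: nat
    by (induction n) (simp_all add: add.assoc)
  obtain a b where m: "m = int a - int b" using int_diff_cases by blast
  obtain c d where n: "n = int c - int d" using int_diff_cases by blast
  have "m + n = int (a + c) - int (b + d)" by (simp add: m n)
  then have "zmul (m + n) x = (\<Sum>_<a + c. x) - (\<Sum>_<b + d. x)" by (simp only: zmul_diff)
  then show ?thesis unfolding m n zmul_diff add by (simp add: algebra_simps)
qed

lemma zmul_0 [simp]: "zmul 0 x = 0" by (simp add: zmul_def)
lemma zmul_1 [simp]: "zmul 1 x = x" by (simp add: zmul_def)

lemma zmul_uminus: "zmul (- n) x = - zmul n x"
  using zmul_add[of n "- n" x] by (simp add: eq_neg_iff_add_eq_0 add.commute)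

lemma zmul_ring: "zmul n (x :: 'a::ring_1) = of_int n * x"
proof -
  obtain a b where n: "n = int a - int b" using int_diff_cases by blast
  show ?thesis unfolding n zmul_diff by (simp add: left_diff_distrib)
qed

text \<open>The additive map on the free abelian group with prescribed values w on generators. Each
  coordinate of \<open>galois_can\<close> is of this kind.\<close>

definition zlin :: "('x \<Rightarrow> 'c::ab_group_add) \<Rightarrow> ('x \<Rightarrow> int) \<Rightarrow> 'c" where
  "zlin w s = (\<Sum>p\<in>fsupp s. zmul (s p) (w p))"

text \<open>Terms of two formal sums may cancel, so the support of a sum can be smaller than the
  union of supports; a common finite index set makes additivity provable.\<close>

lemma zlin_superset:
  "finite A \<Longrightarrow> fsupp s \<subseteq> A \<Longrightarrow> zlin w s = (\<Sum>p\<in>A. zmul (s p) (w p))"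
  unfolding zlin_def by (rule sum.mono_neutral_left) (auto simp: fsupp_def)

lemma zlin_plus:
  assumes "formal_on a X" "formal_on b X"
  shows "zlin w (a + b) = zlin w a + zlin w b"
proof -
  define A where "A = fsupp a \<union> fsupp b"
  have A: "finite A" "fsupp a \<subseteq> A" "fsupp b \<subseteq> A" "fsupp (a + b) \<subseteq> A"
    using assms fsupp_plus[of a b] by (auto simp: A_def formal_on_def)
  show ?thesis
    using A by (simp add: zlin_superset[of A] zmul_add sum.distrib)
qed

lemma zlin_uminus: "zlin w (- a) = - zlin w a"
  by (simp add: zlin_def zmul_uminus sum_negf)

lemma zlin_fsing [simp]: "zlin w (fsing x) = w x"
  by (simp add: zlin_def)

lemma zlin_zero [simp]: "zlin w 0 = 0"
  by (simp add: zlin_def)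

lemma zlin_sum:
  assumes "\<And>j. j \<in> J \<Longrightarrow> formal_on (f j) X"
  shows "zlin w (\<Sum>j\<in>J. f j) = (\<Sum>j\<in>J. zlin w (f j))"
  using assms
  by (induction J rule: infinite_finite_induct) (simp_all add: zlin_plus[where X = X] formal_sum)

lemma fmap_superset:
  "finite A \<Longrightarrow> fsupp s \<subseteq> A \<Longrightarrow> fmap g s q = (\<Sum>p\<in>{p\<in>A. g p = q}. s p)"
  unfolding fmap_def by (rule sum.mono_neutral_left) (auto simp: fsupp_def)

lemma fmap_plus:
  assumes "formal_on a X" "formal_on b X"
  shows "fmap g (a + b) = fmap g a + fmap g b"
proof
  fix q
  define A where "A = fsupp a \<union> fsupp b"
  have A: "finite A" "fsupp a \<subseteq> A" "fsupp b \<subseteq> A" "fsupp (a + b) \<subseteq> A"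
    using assms fsupp_plus[of a b] by (auto simp: A_def formal_on_def)
  show "fmap g (a + b) q = (fmap g a + fmap g b) q"
    using A by (simp add: fmap_superset[of A] sum.distrib)
qed

lemma fmap_uminus: "fmap g (- a) = - fmap g a"
  by (rule ext) (simp add: fmap_def sum_negf)

lemma fmap_zero [simp]: "fmap g 0 = 0"
  by (rule ext) (simp add: fmap_def)

lemma fmap_fsing [simp]: "fmap g (fsing x) = fsing (g x)"
proof
  fix q
  have "{p \<in> {x}. g p = q} = (if g x = q then {x} else {})" by auto
  then show "fmap g (fsing x) q = fsing (g x) q"
    by (simp add: fmap_superset[of "{x}"]) (simp add: fsing_def)
qed

text \<open>The counterpart of \<open>zlin\<close> for groups with a carrier, since the test modules
  in \<open>flat_over\<close> are records.\<close>

definition (in abelian_group) gext :: "('x \<Rightarrow> 'a) \<Rightarrow> ('x \<Rightarrow> int) \<Rightarrow> 'a" where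
  "gext w s = finsum G (\<lambda>p. add_pow G (s p) (w p)) (fsupp s)"

context abelian_group
begin

lemma add_pow_zero_int: "add_pow G (0::int) x = \<zero>"
  by (simp add: add_pow_def)

lemma gext_superset:
  assumes "finite A" "fsupp s \<subseteq> A" "w \<in> A \<rightarrow> carrier G"
  shows "gext w s = finsum G (\<lambda>p. add_pow G (s p) (w p)) A"
  unfolding gext_def
  by (rule add.finprod_mono_neutral_cong_left) (use assms in \<open>auto simp: fsupp_def add_pow_zero_int\<close>)

lemma gext_closed: "formal_on s X \<Longrightarrow> w \<in> X \<rightarrow> carrier G \<Longrightarrow> gext w s \<in> carrier G"
  unfolding gext_def formal_on_def by (intro add.finprod_closed) auto

lemma gext_plus:
  assumes "formal_on a X" "formal_on b X" "w \<in> X \<rightarrow> carrier G"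
  shows "gext w (a + b) = gext w a \<oplus> gext w b"
proof -
  define A where "A = fsupp a \<union> fsupp b"
  have A: "finite A" "fsupp a \<subseteq> A" "fsupp b \<subseteq> A" "fsupp (a + b) \<subseteq> A" "w \<in> A \<rightarrow> carrier G"
    using assms fsupp_plus[of a b] by (auto simp: A_def formal_on_def)
  have "gext w (a + b) = finsum G (\<lambda>p. add_pow G (a p) (w p) \<oplus> add_pow G (b p) (w p)) A"
    unfolding gext_superset[OF A(1,4,5)]
    using A(5) by (intro add.finprod_cong') (auto simp: add.int_pow_mult Pi_iff)
  also have "\<dots> = gext w a \<oplus> gext w b"
    unfolding gext_superset[OF A(1,2,5)] gext_superset[OF A(1,3,5)]
    using A(5) by (intro add.finprod_multf) auto
  finally show ?thesis .
qed

lemma gext_zero [simp]: "gext w 0 = \<zero>"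
  by (simp add: gext_def)

lemma gext_uminus:
  assumes "formal_on a X" "w \<in> X \<rightarrow> carrier G"
  shows "gext w (- a) = \<ominus> gext w a"
proof -
  have "gext w a \<oplus> gext w (- a) = \<zero>"
    using gext_plus[OF assms(1) formal_uminus[OF assms(1)] assms(2)] by simp
  then show ?thesis
    using gext_closed[OF assms] gext_closed[OF formal_uminus[OF assms(1)] assms(2)]
    by (metis minus_equality a_comm)
qed

lemma gext_fsing: "w x \<in> carrier G \<Longrightarrow> gext w (fsing x) = w x"
  by (simp add: gext_def)

end

lemma tensor_rels_eq: "tensor_rels M addM N addN R actM actN =
  zspan ({fsing (addM m1 m2, n) - fsing (m1, n) - fsing (m2, n) | m1 m2 n. m1 \<in> M \<and> m2 \<in> M \<and> n \<in> N}
          \<union> {fsing (m, addN n1 n2) - fsing (m, n1) - fsing (m, n2) | m n1 n2. m \<in> M \<and> n1 \<in> N \<and> n2 \<in> N}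
          \<union> {fsing (actM m r, n) - fsing (m, actN r n) | m r n. m \<in> M \<and> r \<in> R \<and> n \<in> N})"
  by (simp add: tensor_rels_def fun_diff_def)

section \<open>Equality in a tensor product and maps out of it\<close>

locale tensor_relations =
  fixes M :: "'m set" and addM :: "'m \<Rightarrow> 'm \<Rightarrow> 'm" and N :: "'n set" and addN :: "'n \<Rightarrow> 'n \<Rightarrow> 'n"
    and R :: "'r set" and actM :: "'m \<Rightarrow> 'r \<Rightarrow> 'm" and actN :: "'r \<Rightarrow> 'n \<Rightarrow> 'n"
begin

abbreviation rels :: "('m \<times> 'n \<Rightarrow> int) set" where "rels \<equiv> tensor_rels M addM N addN R actM actN"

text \<open>Equality of classes in M \<otimes>_R N; chains of \<open>\<approx>\<close> take the
  place of a quotient type.\<close>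

definition teq :: "('m \<times> 'n \<Rightarrow> int) \<Rightarrow> ('m \<times> 'n \<Rightarrow> int) \<Rightarrow> bool" (infix "\<approx>" 50) where
  "s \<approx> t \<longleftrightarrow> s - t \<in> rels"

lemma teq_zero: "s \<approx> 0 \<longleftrightarrow> s \<in> rels"
  by (simp add: teq_def)

lemma teq_refl [simp]: "s \<approx> s"
  by (simp add: teq_def tensor_rels_eq zspan_0)

lemma teq_sym: "s \<approx> t \<Longrightarrow> t \<approx> s"
  using zspan_uminus[of "s - t"] by (simp add: teq_def tensor_rels_eq)

lemma teq_trans [trans]: "s \<approx> t \<Longrightarrow> t \<approx> u \<Longrightarrow> s \<approx> u"
  using zspan_plus[of "s - t" _ "t - u"] by (simp add: teq_def tensor_rels_eq)

lemma teq_plus: "s \<approx> t \<Longrightarrow> s' \<approx> t' \<Longrightarrow> s + s' \<approx> t + t'"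
  using zspan_plus[of "s - t" _ "s' - t'"] by (simp add: teq_def tensor_rels_eq algebra_simps)

lemma teq_uminus: "s \<approx> t \<Longrightarrow> - s \<approx> - t"
  using zspan_uminus[of "s - t"] by (simp add: teq_def tensor_rels_eq)

lemma teq_sum: "(\<And>j. j \<in> J \<Longrightarrow> f j \<approx> g j) \<Longrightarrow> (\<Sum>j\<in>J. f j) \<approx> (\<Sum>j\<in>J. g j)"
  by (induction J rule: infinite_finite_induct) (auto intro: teq_plus)

lemma teq_add_left: "m1 \<in> M \<Longrightarrow> m2 \<in> M \<Longrightarrow> n \<in> N \<Longrightarrow> fsing (addM m1 m2, n) \<approx> fsing (m1, n) + fsing (m2, n)"
  unfolding teq_def tensor_rels_eq by (rule zspan_gen) (auto simp: diff_diff_eq)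

lemma teq_add_right: "m \<in> M \<Longrightarrow> n1 \<in> N \<Longrightarrow> n2 \<in> N \<Longrightarrow> fsing (m, addN n1 n2) \<approx> fsing (m, n1) + fsing (m, n2)"
  unfolding teq_def tensor_rels_eq by (rule zspan_gen) (auto simp: diff_diff_eq)

lemma teq_balanced: "m \<in> M \<Longrightarrow> r \<in> R \<Longrightarrow> n \<in> N \<Longrightarrow> fsing (actM m r, n) \<approx> fsing (m, actN r n)"
  unfolding teq_def tensor_rels_eq by (rule zspan_gen) auto

lemma teq_cancel: "s \<approx> s + t \<Longrightarrow> t \<approx> 0"
  using zspan_uminus[of "- t"] by (simp add: teq_def tensor_rels_eq)

text \<open>The operation \<open>addM\<close> comes without a zero, so the zero is recognised by
  idempotence: z \<otimes> n = z \<otimes> n + z \<otimes> n.\<close>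

lemma teq_zero_left: "z \<in> M \<Longrightarrow> addM z z = z \<Longrightarrow> n \<in> N \<Longrightarrow> fsing (z, n) \<approx> 0"
  using teq_cancel[of "fsing (z, n)" "fsing (z, n)"] teq_add_left[of z z n] by metis

lemma teq_zero_right: "m \<in> M \<Longrightarrow> z \<in> N \<Longrightarrow> addN z z = z \<Longrightarrow> fsing (m, z) \<approx> 0"
  using teq_cancel[of "fsing (m, z)" "fsing (m, z)"] teq_add_right[of m z z] by metis

lemma teq_uminus_right:
  assumes "m \<in> M" "n \<in> N" "n' \<in> N" "z \<in> N" "addN z z = z" "addN n n' = z"
  shows "fsing (m, n') \<approx> - fsing (m, n)"
proof -
  have "fsing (m, n) + fsing (m, n') \<approx> fsing (m, z)"
    using teq_sym[OF teq_add_right[of m n n']] assms by simp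
  also have "fsing (m, z) \<approx> 0" using assms by (intro teq_zero_right)
  finally show ?thesis by (simp add: teq_def add.commute)
qed

lemma teq_uminus_left:
  assumes "n \<in> N" "m \<in> M" "m' \<in> M" "z \<in> M" "addM z z = z" "addM m m' = z"
  shows "fsing (m', n) \<approx> - fsing (m, n)"
proof -
  have "fsing (m, n) + fsing (m', n) \<approx> fsing (z, n)"
    using teq_sym[OF teq_add_left[of m m' n]] assms by simp
  also have "fsing (z, n) \<approx> 0" using assms by (intro teq_zero_left)
  finally show ?thesis by (simp add: teq_def add.commute)
qed

end

text \<open>Universal property of the tensor product: a balanced biadditive map w factors through
  the quotient.\<close>

lemma (in tensor_relations) gext_rels:
  fixes G (structure)
  assumes G: "abelian_group G"
    and M: "\<And>m m'. m \<in> M \<Longrightarrow> m' \<in> M \<Longrightarrow> addM m m' \<in> M" "\<And>m r. m \<in> M \<Longrightarrow> r \<in> R \<Longrightarrow> actM m r \<in> M"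
    and N: "\<And>n n'. n \<in> N \<Longrightarrow> n' \<in> N \<Longrightarrow> addN n n' \<in> N" "\<And>n r. n \<in> N \<Longrightarrow> r \<in> R \<Longrightarrow> actN r n \<in> N"
    and w: "\<And>m n. m \<in> M \<Longrightarrow> n \<in> N \<Longrightarrow> w (m, n) \<in> carrier G"
    and w1: "\<And>m m' n. m \<in> M \<Longrightarrow> m' \<in> M \<Longrightarrow> n \<in> N \<Longrightarrow> w (addM m m', n) = w (m, n) \<oplus> w (m', n)"
    and w2: "\<And>m n n'. m \<in> M \<Longrightarrow> n \<in> N \<Longrightarrow> n' \<in> N \<Longrightarrow> w (m, addN n n') = w (m, n) \<oplus> w (m, n')"
    and w3: "\<And>m n r. m \<in> M \<Longrightarrow> n \<in> N \<Longrightarrow> r \<in> R \<Longrightarrow> w (actM m r, n) = w (m, actN r n)"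
    and s: "s \<in> rels"
  shows "abelian_group.gext G w s = \<zero>"
proof -
  interpret abelian_group G by (rule G)
  let ?X = "M \<times> N"
  have wX: "w \<in> ?X \<rightarrow> carrier G" using w by auto
  have diff: "gext w (a - b) = gext w a \<ominus> gext w b" if "formal_on a ?X" "formal_on b ?X" for a b
    using gext_plus[OF that(1) formal_uminus[OF that(2)] wX] gext_uminus[OF that(2) wX]
    by (simp add: minus_eq)
  have fs: "formal_on (fsing (m, n)) ?X" "gext w (fsing (m, n)) = w (m, n)" if "m \<in> M" "n \<in> N" for m n
    using that w by (auto intro: formal_fsing gext_fsing)
  \<comment> \<open>The support is tracked with the value because \<open>gext_plus\<close> needs
    both summands to be formal sums over M \<times> N.\<close>
  have "formal_on s ?X \<and> gext w s = \<zero>"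
    using s unfolding tensor_rels_eq
  proof (induction rule: zspan_induct)
    case zero
    show ?case using formal_zero gext_zero by blast
  next
    case (plus a b)
    then have "gext w (a + b) = \<zero>" by (simp add: gext_plus[OF _ _ wX] del: plus_fun_apply)
    with plus show ?case using formal_plus[of a ?X b] by blast
  next
    case (uminus a)
    then have "gext w (- a) = \<zero>" by (simp add: gext_uminus[OF _ wX] del: uminus_apply)
    with uminus show ?case using formal_uminus[of a ?X] by blast
  next
    case (gen g)
    \<comment> \<open>Both additivity relations have the shape a - b - c and are settled by this one
      computation.\<close>
    have three: "formal_on (a - b - c) ?X \<and> gext w (a - b - c) = \<zero>"
      if ab: "formal_on a ?X" "formal_on b ?X" "formal_on c ?X"
        and eq: "gext w a = gext w b \<oplus> gext w c" for a b c
    proof -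
      have carr: "gext w b \<in> carrier G" "gext w c \<in> carrier G"
        using gext_closed[OF ab(2) wX] gext_closed[OF ab(3) wX] by auto
      have "gext w (a - b - c) = (gext w b \<oplus> gext w c) \<ominus> gext w b \<ominus> gext w c"
        unfolding diff[OF formal_minus[OF ab(1,2)] ab(3)] diff[OF ab(1,2)] eq ..
      also have "\<dots> = gext w c \<oplus> (gext w b \<oplus> (\<ominus> gext w b \<oplus> \<ominus> gext w c))"
        unfolding minus_eq a_comm[OF carr] using carr by (simp add: a_assoc)
      also have "\<dots> = \<zero>" using carr by (simp add: r_neg2 r_neg)
      finally show ?thesis using ab by (blast intro: formal_minus)
    qed
    from gen consider 
      (a) m m' n where "g = fsing (addM m m', n) - fsing (m, n) - fsing (m', n)" "m \<in> M" "m' \<in> M" "n \<in> N"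
    | (b) m n n' where "g = fsing (m, addN n n') - fsing (m, n) - fsing (m, n')" "m \<in> M" "n \<in> N" "n' \<in> N"
    | (c) m r n where "g = fsing (actM m r, n) - fsing (m, actN r n)" "m \<in> M" "r \<in> R" "n \<in> N"
      by fast
    then show ?case
    proof cases
      case a
      show ?thesis unfolding a(1)
        by (rule three) (simp_all only: fs M a w1)
    next
      case b
      show ?thesis unfolding b(1)
        by (rule three) (simp_all only: fs N b w2)
    next
      case c
      have f1: "formal_on (fsing (actM m r, n)) ?X" and f2: "formal_on (fsing (m, actN r n)) ?X"
        by (rule fs; intro M N c)+
      have "gext w (fsing (actM m r, n)) = gext w (fsing (m, actN r n))"
        by (simp only: fs M N c w3)
      then have "gext w (fsing (actM m r, n) - fsing (m, actN r n)) = \<zero>"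
        unfolding diff[OF f1 f2] minus_eq using gext_closed[OF f2 wX] by (simp add: r_neg)
      then show ?thesis unfolding c(1) using formal_minus[OF f1 f2] by blast
    qed
  qed
  then show ?thesis by simp
qed

section \<open>Faithful flatness from dual bases\<close>

lemma choice3:
  assumes "\<forall>i. \<exists>a b c. P i a b c"
  shows "\<exists>a b c. \<forall>i. P i (a i) (b i) (c i)"
  using assms by metis

lemma teq_sum_left:
  fixes M :: "'c::ab_group_add set"
  assumes "0 \<in> M" "\<And>m m'. m \<in> M \<Longrightarrow> m' \<in> M \<Longrightarrow> m + m' \<in> M" "n \<in> N"
    and "finite J" "\<And>j. j \<in> J \<Longrightarrow> f j \<in> M"
  shows "tensor_relations.teq M (+) N addN R actM actN (fsing (\<Sum>j\<in>J. f j, n)) (\<Sum>j\<in>J. fsing (f j, n))"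
proof -
  interpret tensor_relations M "(+)" N addN R actM actN .
  have sum: "(\<Sum>j\<in>A. f j) \<in> M" if "A \<subseteq> J" for A
    using that by (induction A rule: infinite_finite_induct) (auto intro: assms)
  have "teq (fsing (\<Sum>j\<in>A. f j, n)) ((\<Sum>j\<in>A. fsing (f j, n)))" if "finite A" "A \<subseteq> J" for A
    using that
  proof (induction A rule: finite_induct)
    case empty
    have "teq (fsing (0, n)) 0" using assms(1,3) by (intro teq_zero_left) auto
    then show ?case by (simp only: sum.empty)
  next
    case (insert j A)
    have "teq (fsing (f j + (\<Sum>j\<in>A. f j), n)) (fsing (f j, n) + fsing (\<Sum>j\<in>A. f j, n))"
      using insert.prems sum[of A] assms(3,5) by (intro teq_add_left) auto
    also have "teq \<dots> (fsing (f j, n) + (\<Sum>j\<in>A. fsing (f j, n)))"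
      using insert by (intro teq_plus) auto
    finally show ?case using insert.hyps by (simp del: plus_fun_apply)
  qed
  then show ?thesis using assms(4) by blast
qed

lemma teq_sum_right:
  fixes N :: "'c::ab_group_add set"
  assumes "0 \<in> N" "\<And>m m'. m \<in> N \<Longrightarrow> m' \<in> N \<Longrightarrow> m + m' \<in> N" "m \<in> M"
    and "finite J" "\<And>j. j \<in> J \<Longrightarrow> f j \<in> N"
  shows "tensor_relations.teq M addM N (+) R actM actN (fsing (m, \<Sum>j\<in>J. f j)) (\<Sum>j\<in>J. fsing (m, f j))"
proof -
  interpret tensor_relations M addM N "(+)" R actM actN .
  have sum: "(\<Sum>j\<in>A. f j) \<in> N" if "A \<subseteq> J" for A
    using that by (induction A rule: infinite_finite_induct) (auto intro: assms)
  have "teq (fsing (m, \<Sum>j\<in>A. f j)) ((\<Sum>j\<in>A. fsing (m, f j)))" if "finite A" "A \<subseteq> J" for A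
    using that
  proof (induction A rule: finite_induct)
    case empty
    have "teq (fsing (m, 0)) 0" using assms(1,3) by (intro teq_zero_right) auto
    then show ?case by (simp only: sum.empty)
  next
    case (insert j A)
    have "teq (fsing (m, f j + (\<Sum>j\<in>A. f j))) (fsing (m, f j) + fsing (m, \<Sum>j\<in>A. f j))"
      using insert.prems sum[of A] assms(3,5) by (intro teq_add_right) auto
    also have "teq \<dots> (fsing (m, f j) + (\<Sum>j\<in>A. fsing (m, f j)))"
      using insert by (intro teq_plus) auto
    finally show ?case using insert.hyps by (simp del: plus_fun_apply)
  qed
  then show ?thesis using assms(4) by blast
qed

section \<open>Linear forms and dual bases\<close>

locale right_linear_form =
  fixes mlt :: "'c::ab_group_add \<Rightarrow> 'c \<Rightarrow> 'c" and un1 :: 'c and M R0 :: "'c set" and \<tau> :: "'c \<Rightarrow> 'c"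
  assumes M_add: "\<And>m m'. m \<in> M \<Longrightarrow> m' \<in> M \<Longrightarrow> m + m' \<in> M"
    and M_mlt: "\<And>m r. m \<in> M \<Longrightarrow> r \<in> R0 \<Longrightarrow> mlt m r \<in> M"
    and form_closed: "\<And>m. m \<in> M \<Longrightarrow> \<tau> m \<in> R0"
    and form_add: "\<And>m m'. m \<in> M \<Longrightarrow> m' \<in> M \<Longrightarrow> \<tau> (m + m') = \<tau> m + \<tau> m'"
    and form_mlt: "\<And>m r. m \<in> M \<Longrightarrow> r \<in> R0 \<Longrightarrow> \<tau> (mlt m r) = mlt (\<tau> m) r"
begin

abbreviation R :: "'c ring" where
  "R \<equiv> \<lparr>carrier = R0, monoid.mult = mlt, one = un1, zero = 0, add = (+)\<rparr>"

text \<open>On generators, the map tau \<otimes> id from M \<otimes> N to N;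
  \<open>gext_pairing_rels\<close> shows that it is well defined.\<close>

definition pairing :: "('c, 'n) module \<Rightarrow> 'c \<times> 'n \<Rightarrow> 'n" where
  "pairing N = (\<lambda>(m, n). smult N (\<tau> m) n)"

lemma pairing_closed:
  assumes "module R N" shows "pairing N \<in> M \<times> carrier N \<rightarrow> carrier N"
proof -
  interpret module R N by fact
  show ?thesis using smult_closed form_closed by (auto simp: pairing_def)
qed

lemma gext_pairing_rels:
  assumes N: "module R N" and s: "s \<in> tens_rels R M N"
  shows "abelian_group.gext N (pairing N) s = \<zero>\<^bsub>N\<^esub>"
proof -
  interpret module R N by fact
  interpret tensor_relations M "add R" "carrier N" "add N" "carrier R" "mult R" "smult N" .
  show ?thesis
  proof (rule gext_rels)
    show "abelian_group N" by unfold_locales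
    show "s \<in> rels" using s by (simp add: tens_rels_def)
  qed (use M_add M_mlt form_closed form_add form_mlt smult_closed smult_l_distr smult_r_distr smult_assoc1
      in \<open>auto simp: pairing_def\<close>)
qed

end

lemma rlinear_zero:
  assumes "module R N1" "module R N2" "rlinear R N1 N2 f"
  shows "f \<zero>\<^bsub>N1\<^esub> = \<zero>\<^bsub>N2\<^esub>"
proof -
  interpret N1: module R N1 by fact
  interpret N2: module R N2 by fact
  have "f \<zero>\<^bsub>N1\<^esub> = f \<zero>\<^bsub>N1\<^esub> \<oplus>\<^bsub>N2\<^esub> f \<zero>\<^bsub>N1\<^esub>" "f \<zero>\<^bsub>N1\<^esub> \<in> carrier N2"
    using assms(3) N1.zero_closed N1.l_zero[of "\<zero>\<^bsub>N1\<^esub>"] unfolding rlinear_def by (metis, auto)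
  then show ?thesis by (metis N2.add.l_cancel_one)
qed

text \<open>Finite projectivity of M over R0 in coordinates: the functionals tau_j and the elements
  x_j form dual bases. Flatness then becomes a statement about finitely many coordinates.\<close>

locale dual_basis =
  fixes mlt :: "'c::ab_group_add \<Rightarrow> 'c \<Rightarrow> 'c" and un1 :: 'c and M R0 :: "'c set"
    and J :: "'j set" and x :: "'j \<Rightarrow> 'c" and \<tau> :: "'j \<Rightarrow> 'c \<Rightarrow> 'c"
  assumes lin: "\<And>j. j \<in> J \<Longrightarrow> right_linear_form mlt M R0 (\<tau> j)"
    and M_zero: "0 \<in> M"
    and M_plus: "\<And>m m'. m \<in> M \<Longrightarrow> m' \<in> M \<Longrightarrow> m + m' \<in> M"
    and M_mult: "\<And>m r. m \<in> M \<Longrightarrow> r \<in> R0 \<Longrightarrow> mlt m r \<in> M"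
    and finite_J: "finite J"
    and x_closed: "\<And>j. j \<in> J \<Longrightarrow> x j \<in> M"
    and expand: "\<And>m. m \<in> M \<Longrightarrow> (\<Sum>j\<in>J. mlt (x j) (\<tau> j m)) = m"
begin

abbreviation R :: "'c ring" where
  "R \<equiv> \<lparr>carrier = R0, monoid.mult = mlt, one = un1, zero = 0, add = (+)\<rparr>"

abbreviation "pairing j \<equiv> right_linear_form.pairing (\<tau> j)"

text \<open>From m \<otimes> n = sum_j x_j tau_j(m) \<otimes> n = sum_j x_j \<otimes> tau_j(m) n: a
  tensor is determined by its coordinates (tau_j \<otimes> id)(s) in N.\<close>

lemma tensor_expand:
  fixes N :: "('c, 'n) module"
  assumes N: "module R N" and s: "formal_on s (M \<times> carrier N)"
  shows "tensor_relations.teq M (+) (carrier N) (add N) R0 mlt (smult N) s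
    (\<Sum>j\<in>J. fsing (x j, abelian_group.gext N (pairing j N) s))"
proof -
  interpret module R N by fact
  interpret tensor_relations M "(+)" "carrier N" "add N" R0 mlt "smult N" .
  have pc: "pairing j N \<in> M \<times> carrier N \<rightarrow> carrier N" if "j \<in> J" for j
    using right_linear_form.pairing_closed[OF lin[OF that] N] .
  show ?thesis using s
  proof (induction rule: formal_induct)
    case zero
    have "teq ((\<Sum>j\<in>J. fsing (x j, \<zero>\<^bsub>N\<^esub>))) ((\<Sum>j\<in>J. 0))"
      using x_closed by (intro teq_sum teq_zero_right) auto
    then have "teq ((\<Sum>j\<in>J. fsing (x j, gext (pairing j N) 0))) 0"
      by (simp only: gext_zero sum.neutral_const)
    then show ?case by (rule teq_sym)
  next
    case (fsing p)
    obtain m n where p: "p = (m, n)" "m \<in> M" "n \<in> carrier N" using fsing by auto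
    have \<tau>: "\<tau> j m \<in> R0" if "j \<in> J" for j
      using lin[OF that] p(2) by (simp add: right_linear_form_def)
    have "teq (fsing (m, n)) ((\<Sum>j\<in>J. fsing (mlt (x j) (\<tau> j m), n)))"
      using teq_sum_left[of M n "carrier N" J "\<lambda>j. mlt (x j) (\<tau> j m)"] p M_zero M_plus finite_J
        expand[OF p(2)] x_closed M_mult \<tau> by simp
    also have "teq \<dots> ((\<Sum>j\<in>J. fsing (x j, smult N (\<tau> j m) n)))"
      using p \<tau> x_closed by (intro teq_sum teq_balanced) auto
    also have "(\<Sum>j\<in>J. fsing (x j, smult N (\<tau> j m) n)) = (\<Sum>j\<in>J. fsing (x j, gext (pairing j N) (fsing p)))"
    proof (intro sum.cong refl)
      fix j assume j: "j \<in> J"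
      have "pairing j N p = smult N (\<tau> j m) n"
        by (simp add: p(1) right_linear_form.pairing_def[OF lin[OF j]])
      moreover have "pairing j N p \<in> carrier N" using pc[OF j] fsing by auto
      ultimately show "fsing (x j, smult N (\<tau> j m) n) = fsing (x j, gext (pairing j N) (fsing p))"
        by (simp add: gext_fsing)
    qed
    finally show ?case unfolding p(1) .
  next
    case (plus a b)
    have "teq (a + b) ((\<Sum>j\<in>J. fsing (x j, gext (pairing j N) a)) + (\<Sum>j\<in>J. fsing (x j, gext (pairing j N) b)))"
      by (rule teq_plus[OF plus(3,4)])
    also have "\<dots> = (\<Sum>j\<in>J. fsing (x j, gext (pairing j N) a) + fsing (x j, gext (pairing j N) b))"
      by (rule sum.distrib[symmetric])
    also have "teq \<dots> ((\<Sum>j\<in>J. fsing (x j, gext (pairing j N) a \<oplus>\<^bsub>N\<^esub> gext (pairing j N) b)))"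
      using x_closed gext_closed[OF plus(1) pc] gext_closed[OF plus(2) pc]
      by (intro teq_sum teq_sym[OF teq_add_right])
    also have "\<dots> = (\<Sum>j\<in>J. fsing (x j, gext (pairing j N) (a + b)))"
      by (intro sum.cong refl) (simp only: gext_plus[OF plus(1,2) pc])
    finally show ?case .
  next
    case (uminus a)
    have "teq (- a) (- (\<Sum>j\<in>J. fsing (x j, gext (pairing j N) a)))"
      by (rule teq_uminus[OF uminus(2)])
    also have "\<dots> = (\<Sum>j\<in>J. - fsing (x j, gext (pairing j N) a))"
      by (rule sum_negf[symmetric])
    also have "teq \<dots> ((\<Sum>j\<in>J. fsing (x j, \<ominus>\<^bsub>N\<^esub> gext (pairing j N) a)))"
      using x_closed gext_closed[OF uminus(1) pc]
      by (intro teq_sum teq_sym[OF teq_uminus_right[where z = "\<zero>\<^bsub>N\<^esub>"]]) (auto simp: r_neg)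
    also have "\<dots> = (\<Sum>j\<in>J. fsing (x j, gext (pairing j N) (- a)))"
      by (intro sum.cong refl) (simp only: gext_uminus[OF uminus(1) pc])
    finally show ?case .
  qed
qed

text \<open>Naturality of tau_j \<otimes> id in the module, which comes from f(tau_j(m) n) =
  tau_j(m) f(n).\<close>

lemma gext_pairing_fmap:
  fixes N1 N2 :: "('c, 'n) module"
  assumes N1: "module R N1" and N2: "module R N2" and f: "rlinear R N1 N2 f" and j: "j \<in> J"
    and s: "formal_on s (M \<times> carrier N1)"
  shows "abelian_group.gext N2 (pairing j N2) (fmap (\<lambda>(m, n). (m, f n)) s) =
      f (abelian_group.gext N1 (pairing j N1) s)"
proof -
  interpret N1: module R N1 by fact
  interpret N2: module R N2 by fact
  let ?h = "\<lambda>(m, n). (m, f n)"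
  have pc1: "pairing j N1 \<in> M \<times> carrier N1 \<rightarrow> carrier N1"
    using right_linear_form.pairing_closed[OF lin[OF j] N1] .
  have pc2: "pairing j N2 \<in> M \<times> carrier N2 \<rightarrow> carrier N2"
    using right_linear_form.pairing_closed[OF lin[OF j] N2] .
  have fc: "f n \<in> carrier N2" if "n \<in> carrier N1" for n
    using f that by (auto simp: rlinear_def)
  have fadd: "f (n \<oplus>\<^bsub>N1\<^esub> n') = f n \<oplus>\<^bsub>N2\<^esub> f n'" if "n \<in> carrier N1" "n' \<in> carrier N1" for n n'
    using f that by (auto simp: rlinear_def)
  have f0: "f \<zero>\<^bsub>N1\<^esub> = \<zero>\<^bsub>N2\<^esub>"
    by (rule rlinear_zero[OF N1 N2 f])
  have fneg: "f (\<ominus>\<^bsub>N1\<^esub> n) = \<ominus>\<^bsub>N2\<^esub> f n" if "n \<in> carrier N1" for n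
    using fadd[of "\<ominus>\<^bsub>N1\<^esub> n" n] fc that f0 by (intro N2.minus_equality[symmetric]) (simp_all add: N1.l_neg)
  \<comment> \<open>The image must be known to be a formal sum over M \<times> N2 before
    \<open>N2.gext\<close> can be split on it.\<close>
  have "formal_on (fmap ?h s) (M \<times> carrier N2) \<and>
      N2.gext (pairing j N2) (fmap ?h s) = f (N1.gext (pairing j N1) s)"
    using s
  proof (induction rule: formal_induct)
    case zero
    show ?case by (simp only: fmap_zero formal_zero N1.gext_zero N2.gext_zero f0)
  next
    case (fsing p)
    obtain m n where p: "p = (m, n)" "m \<in> M" "n \<in> carrier N1" using fsing by auto
    have \<tau>: "\<tau> j m \<in> R0"
      using lin[OF j] p(2) by (simp add: right_linear_form_def)
    have "pairing j N2 (m, f n) = f (pairing j N1 (m, n))"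
      using f \<tau> p(3) by (simp add: right_linear_form.pairing_def[OF lin[OF j]] rlinear_def)
    moreover have "pairing j N2 (m, f n) \<in> carrier N2" "pairing j N1 (m, n) \<in> carrier N1"
      using pc1 pc2 p fc by auto
    ultimately show ?case
      using p fc by (simp add: N1.gext_fsing N2.gext_fsing formal_fsing)
  next
    case (plus a b)
    show ?case
      using plus(3,4) N1.gext_closed[OF plus(1) pc1] N1.gext_closed[OF plus(2) pc1]
      by (simp add: fmap_plus[OF plus(1,2)] formal_plus N1.gext_plus[OF plus(1,2) pc1]
          N2.gext_plus[OF _ _ pc2] fadd del: plus_fun_apply)
  next
    case (uminus a)
    show ?case
      using uminus(2) N1.gext_closed[OF uminus(1) pc1]
      by (simp add: fmap_uminus formal_uminus N1.gext_uminus[OF uminus(1) pc1]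
          N2.gext_uminus[OF _ pc2] fneg del: uminus_apply)
  qed
  then show ?thesis by blast
qed

text \<open>If id \<otimes> f kills s, naturality shows that f kills the coordinates of s.
  Injectivity makes these zero, and \<open>tensor_expand\<close> then gives s = 0 in the tensor
  product.\<close>

lemma flat_over_dual_basis: "flat_over TYPE('n) R M"
  unfolding flat_over_def
proof (intro allI impI)
  fix N1 N2 :: "('c, 'n) module" and f s
  assume N1: "module R N1" and N2: "module R N2" and f: "rlinear R N1 N2 f"
    and inj: "inj_on f (carrier N1)" and s: "formal_on s (M \<times> carrier N1)"
    and rel: "fmap (\<lambda>(m, n). (m, f n)) s \<in> tens_rels R M N2"
  interpret N1: module R N1 by fact
  interpret N2: module R N2 by fact
  interpret tensor_relations M "(+)" "carrier N1" "add N1" R0 mlt "smult N1" .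
  have f0: "f \<zero>\<^bsub>N1\<^esub> = \<zero>\<^bsub>N2\<^esub>"
    by (rule rlinear_zero[OF N1 N2 f])
  have zero: "N1.gext (pairing j N1) s = \<zero>\<^bsub>N1\<^esub>" if j: "j \<in> J" for j
  proof -
    have "f (N1.gext (pairing j N1) s) = f \<zero>\<^bsub>N1\<^esub>"
      using right_linear_form.gext_pairing_rels[OF lin[OF j] N2 rel]
      by (simp add: gext_pairing_fmap[OF N1 N2 f j s] f0)
    moreover have "N1.gext (pairing j N1) s \<in> carrier N1"
      using N1.gext_closed[OF s right_linear_form.pairing_closed[OF lin[OF j] N1]] .
    ultimately show ?thesis using inj by (simp add: inj_on_eq_iff)
  qed
  have "teq s ((\<Sum>j\<in>J. fsing (x j, N1.gext (pairing j N1) s)))"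
    by (rule tensor_expand[OF N1 s])
  also have "\<dots> = (\<Sum>j\<in>J. fsing (x j, \<zero>\<^bsub>N1\<^esub>))"
    by (intro sum.cong refl) (simp only: zero)
  also have "teq \<dots> ((\<Sum>j\<in>J. 0))"
    using x_closed by (intro teq_sum teq_zero_right) auto
  finally show "s \<in> tens_rels R M N1" by (simp add: teq_zero tens_rels_def)
qed

text \<open>Since t(1) n = n, the form t yields a retraction of n \<mapsto> 1 \<otimes> n, so N
  embeds into M \<otimes> N.\<close>

lemma faithfully_flat_over_dual_basis:
  assumes t: "right_linear_form mlt M R0 t" and one: "un1 \<in> M" "t un1 = un1"
  shows "faithfully_flat_over TYPE('n) R M"
  unfolding faithfully_flat_over_def
proof (intro conjI allI impI)
  show "flat_over TYPE('n) R M" by (rule flat_over_dual_basis)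
next
  fix N :: "('c, 'n) module"
  assume N: "module R N" and all: "\<forall>s. formal_on s (M \<times> carrier N) \<longrightarrow> s \<in> tens_rels R M N"
  interpret module R N by fact
  interpret t: right_linear_form mlt un1 M R0 t by (rule t)
  have "n = \<zero>\<^bsub>N\<^esub>" if n: "n \<in> carrier N" for n
  proof -
    have "fsing (un1, n) \<in> tens_rels R M N"
      using all n one by (simp add: formal_fsing)
    then have "gext (t.pairing N) (fsing (un1, n)) = \<zero>\<^bsub>N\<^esub>"
      by (rule t.gext_pairing_rels[OF N])
    moreover have "t.pairing N (un1, n) = n"
      using smult_one[OF n] by (simp add: t.pairing_def one)
    ultimately show ?thesis using n by (simp add: gext_fsing)
  qed
  then show "carrier N = {\<zero>\<^bsub>N\<^esub>}" by auto
qed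

text \<open>Here the second factor is expanded: m \<otimes> n = sum_j m tau_j(n) \<otimes> x_j,
  where R0 must commute with M for tau_j(n) to cross the tensor sign. This side is chosen because
  the coefficients m tau_j(n) can be read off from the canonical map.\<close>

lemma tensor_self_expand:
  assumes M_R: "\<And>m r. r \<in> R0 \<Longrightarrow> m \<in> M \<Longrightarrow> mlt m r = mlt r m"
    and dist: "\<And>a b c. mlt (a + b) c = mlt a c + mlt b c"
    and s: "formal_on s (M \<times> M)"
    and M_uminus: "\<And>m. m \<in> M \<Longrightarrow> - m \<in> M"
  shows "tensor_relations.teq M (+) M (+) R0 mlt mlt s
    (\<Sum>j\<in>J. fsing (zlin (\<lambda>p. mlt (fst p) (\<tau> j (snd p))) s, x j))"
proof -
  interpret tensor_relations M "(+)" M "(+)" R0 mlt mlt .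
  let ?w = "\<lambda>j p. mlt (fst p) (\<tau> j (snd p))"
  have \<tau>: "\<tau> j m \<in> R0" if "j \<in> J" "m \<in> M" for j m
    using lin[OF that(1)] that(2) by (simp add: right_linear_form_def)
  have closed: "zlin (?w j) s \<in> M" if "formal_on s (M \<times> M)" "j \<in> J" for s j
    using that(1)
  proof (induction rule: formal_induct)
    case zero show ?case using M_zero by (simp only: zlin_zero)
  next
    case (fsing p) then show ?case using \<tau>[OF that(2)] M_mult by auto
  next
    case (plus a b) then show ?case by (simp only: zlin_plus[OF plus(1,2)] M_plus)
  next
    case (uminus a) then show ?case by (simp only: zlin_uminus M_uminus)
  qed
  show ?thesis using s
  proof (induction rule: formal_induct)
    case zero
    have "teq ((\<Sum>j\<in>J. fsing (0, x j))) ((\<Sum>j\<in>J. 0))"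
      using x_closed M_zero by (intro teq_sum teq_zero_left) auto
    then have "teq ((\<Sum>j\<in>J. fsing (zlin (?w j) 0, x j))) 0"
      by (simp only: zlin_zero sum.neutral_const)
    then show ?case by (rule teq_sym)
  next
    case (fsing p)
    obtain m n where p: "p = (m, n)" "m \<in> M" "n \<in> M" using fsing by auto
    have "teq (fsing (m, n)) ((\<Sum>j\<in>J. fsing (m, mlt (x j) (\<tau> j n))))"
      using teq_sum_right[of M m M J "\<lambda>j. mlt (x j) (\<tau> j n)"] p M_zero M_plus finite_J
        expand[OF p(3)] x_closed M_mult \<tau> by simp
    also have "\<dots> = (\<Sum>j\<in>J. fsing (m, mlt (\<tau> j n) (x j)))"
    proof (intro sum.cong refl)
      fix j assume j: "j \<in> J"
      show "fsing (m, mlt (x j) (\<tau> j n)) = fsing (m, mlt (\<tau> j n) (x j))"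
        by (simp only: M_R[OF \<tau>[OF j p(3)] x_closed[OF j]])
    qed
    also have "teq \<dots> ((\<Sum>j\<in>J. fsing (mlt m (\<tau> j n), x j)))"
      using p \<tau> x_closed by (intro teq_sum teq_sym[OF teq_balanced]) auto
    also have "\<dots> = (\<Sum>j\<in>J. fsing (zlin (?w j) (fsing p), x j))"
      by (simp add: p(1))
    finally show ?case unfolding p(1) .
  next
    case (plus a b)
    have "teq (a + b) ((\<Sum>j\<in>J. fsing (zlin (?w j) a, x j)) + (\<Sum>j\<in>J. fsing (zlin (?w j) b, x j)))"
      by (rule teq_plus[OF plus(3,4)])
    also have "\<dots> = (\<Sum>j\<in>J. fsing (zlin (?w j) a, x j) + fsing (zlin (?w j) b, x j))"
      by (rule sum.distrib[symmetric])
    also have "teq \<dots> ((\<Sum>j\<in>J. fsing (zlin (?w j) a + zlin (?w j) b, x j)))"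
      using x_closed closed[OF plus(1)] closed[OF plus(2)]
      by (intro teq_sum teq_sym[OF teq_add_left])
    also have "\<dots> = (\<Sum>j\<in>J. fsing (zlin (?w j) (a + b), x j))"
      by (simp only: zlin_plus[OF plus(1,2)])
    finally show ?case .
  next
    case (uminus a)
    have "teq (- a) (- (\<Sum>j\<in>J. fsing (zlin (?w j) a, x j)))"
      by (rule teq_uminus[OF uminus(2)])
    also have "\<dots> = (\<Sum>j\<in>J. - fsing (zlin (?w j) a, x j))"
      by (rule sum_negf[symmetric])
    also have "teq \<dots> ((\<Sum>j\<in>J. fsing (- zlin (?w j) a, x j)))"
      using x_closed closed[OF uminus(1)] M_zero M_uminus
      by (intro teq_sum teq_sym[OF teq_uminus_left[where z = 0]]) auto
    also have "\<dots> = (\<Sum>j\<in>J. fsing (zlin (?w j) (- a), x j))"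
      by (simp only: zlin_uminus)
    finally show ?case .
  qed
qed

end

section \<open>Comodule algebras\<close>

text \<open>Product, unit and scalar action are parameters because the same theory is applied to A
  with its ring product and to polynomials over A with \<open>ore_mult\<close>.\<close>

locale comod_alg = comm_hopf mu un com eps ant + k_alg sc mlt un1
  for mu :: "'i::finite \<Rightarrow> 'i \<Rightarrow> 'i \<Rightarrow> 'k::field_char_0"
    and un :: "'i \<Rightarrow> 'k" and com :: "'i \<Rightarrow> 'i \<Rightarrow> 'i \<Rightarrow> 'k"
    and eps :: "'i \<Rightarrow> 'k" and ant :: "'i \<Rightarrow> 'i \<Rightarrow> 'k"
    and sc :: "'k \<Rightarrow> 'c::ab_group_add \<Rightarrow> 'c" and mlt :: "'c \<Rightarrow> 'c \<Rightarrow> 'c" and un1 :: 'c +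
  fixes rho :: "'c \<Rightarrow> 'i \<Rightarrow> 'c"
  assumes rho_add: "rho (x + y) i = rho x i + rho y i"
    and rho_sc: "rho (sc c x) i = sc c (rho x i)"
    and rho_coassoc: "rho (rho x i) j = (\<Sum>k\<in>UNIV. sc (com k j i) (rho x k))"
    and rho_counit: "(\<Sum>k\<in>UNIV. sc (eps k) (rho x k)) = x"
    and rho_mult: "rho (mlt x y) k = (\<Sum>i\<in>UNIV. \<Sum>j\<in>UNIV. sc (mu i j k) (mlt (rho x i) (rho y j)))"
    and rho_one: "rho un1 k = sc (un k) un1"
begin

lemma rho_zero [simp]: "rho 0 i = 0"
  using rho_add[of 0 0 i] by simp

lemma rho_sum: "rho (\<Sum>j\<in>J. f j) i = (\<Sum>j\<in>J. rho (f j) i)"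
  by (induction J rule: infinite_finite_induct) (simp_all add: rho_add)

text \<open>The right antipode axiom multiplied by e_j, that is e_j k_1 S(k_2) = eps(k) e_j in
  Sweedler notation.\<close>

lemma antipode_coord:
  "(\<Sum>a\<in>UNIV. \<Sum>b\<in>UNIV. \<Sum>p\<in>UNIV. \<Sum>q\<in>UNIV. com k a b * (mu j a p * ant b q * mu p q i)) = eps k * hbasis j i"
proof -
  have "hsc (eps k) (hbasis j) = hmul mu (hbasis j) (hsc (eps k) un)"
    by (simp add: H.mlt_sc_right)
  also have "\<dots> = (\<Sum>a\<in>UNIV. \<Sum>b\<in>UNIV. hsc (com k a b) (hmul mu (hmul mu (hbasis j) (hbasis a)) (ant b)))"
    by (simp only: antipode_right[symmetric] H.mlt_sum_right H.mlt_sc_right H.mlt_assoc)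
  finally have eq: "hsc (eps k) (hbasis j) = \<dots>" .
  have "hmul mu (hmul mu (hbasis j) (hbasis a)) (ant b) i =
      (\<Sum>p\<in>UNIV. \<Sum>q\<in>UNIV. mu j a p * ant b q * mu p q i)" for a b
    unfolding hmul_def[of mu "hmul mu (hbasis j) (hbasis a)"] hmul_hbasis ..
  then show ?thesis
    using fun_cong[OF eq, of i] by (simp only: sum_fun_apply hsc_def sum_distrib_left)
qed

text \<open>The formula behind \<open>z\<^sub>0 c \<otimes> z\<^sub>1 = (z c\<^sub>0)\<^sub>0 \<otimes> (z c\<^sub>0)\<^sub>1 S(c\<^sub>1)\<close>; it will be applied to
  the multiplication and to its opposite.\<close>

lemma mult_rho_left:
  assumes op_sum: "\<And>z f. op z (\<Sum>k\<in>(UNIV::'i set). f k) = (\<Sum>k\<in>UNIV. op z (f k))"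
    and op_sc: "\<And>z c x. op z (sc c x) = sc c (op z x)"
    and op_rho: "\<And>x y k. rho (op x y) k = (\<Sum>i\<in>UNIV. \<Sum>j\<in>UNIV. sc (mu i j k) (op (rho x i) (rho y j)))"
  shows "op (rho z i) c = (\<Sum>b\<in>UNIV. \<Sum>p\<in>UNIV. \<Sum>q\<in>UNIV. sc (ant b q * mu p q i) (rho (op z (rho c b)) p))"
proof -
  have "op (rho z i) c = (\<Sum>k\<in>UNIV. sc (eps k) (op (rho z i) (rho c k)))"
    by (subst (1) rho_counit[of c, symmetric]) (simp only: op_sum op_sc)
  also have "\<dots> = (\<Sum>k\<in>UNIV. \<Sum>j\<in>UNIV. sc (eps k * hbasis j i) (op (rho z j) (rho c k)))"
    by (simp only: hbasis_def scale_scale[symmetric] sc_delta) simp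
  \<comment> \<open>In the second factor, z_1 eps(c_1) is replaced by z_1 c_1 S(c_2).\<close>
  also have "\<dots> = (\<Sum>k\<in>UNIV. \<Sum>j\<in>UNIV. \<Sum>a\<in>UNIV. \<Sum>b\<in>UNIV. \<Sum>p\<in>UNIV. \<Sum>q\<in>UNIV.
      sc (com k a b * (mu j a p * ant b q * mu p q i)) (op (rho z j) (rho c k)))"
    by (simp only: antipode_coord[symmetric] scale_sum_left)
  \<comment> \<open>With j, a and k innermost, coassociativity rebuilds the coaction on
    \<open>rho c b\<close>, and multiplicativity then rebuilds the coaction on the product.\<close>
  also have "\<dots> = (\<Sum>b\<in>UNIV. \<Sum>p\<in>UNIV. \<Sum>q\<in>UNIV. \<Sum>j\<in>UNIV. \<Sum>a\<in>UNIV. \<Sum>k\<in>UNIV.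
      sc (com k a b * (mu j a p * ant b q * mu p q i)) (op (rho z j) (rho c k)))"
    unfolding sum.cartesian_product UNIV_Times_UNIV
    by (rule sum.reindex_bij_witness[of _ "\<lambda>(b, p, q, j, a, k). (k, j, a, b, p, q)" "\<lambda>(k, j, a, b, p, q). (b, p, q, j, a, k)"]) auto
  also have "\<dots> = (\<Sum>b\<in>UNIV. \<Sum>p\<in>UNIV. \<Sum>q\<in>UNIV. sc (ant b q * mu p q i) (rho (op z (rho c b)) p))"
    by (simp only: op_rho rho_coassoc op_sum op_sc scale_sum_right scale_scale mult_ac)
  finally show ?thesis .
qed

section \<open>The centre, its coinvariants and the trace\<close>

abbreviation Z :: "'c set" where "Z \<equiv> center mlt UNIV"

lemma center_commute: "z \<in> Z \<Longrightarrow> mlt z x = mlt x z"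
  by (simp add: center_def)

lemma centerI: "(\<And>x. mlt z x = mlt x z) \<Longrightarrow> z \<in> Z"
  by (simp add: center_def)

text \<open>\<open>mult_rho_left\<close> writes z_0 c \<otimes> z_1 through the products z c_0
  alone, and its mirror image writes c z_0 \<otimes> z_1 in the same way through c_0 z.\<close>

lemma center_rho:
  assumes "z \<in> Z" shows "rho z i \<in> Z"
proof (rule centerI)
  fix c
  have "mlt (rho z i) c = (\<Sum>b\<in>UNIV. \<Sum>p\<in>UNIV. \<Sum>q\<in>UNIV. sc (ant b q * mu p q i) (rho (mlt z (rho c b)) p))"
    by (rule mult_rho_left[of mlt]) (simp_all only: mlt_sum_right mlt_sc_right rho_mult)
  also have "\<dots> = (\<Sum>b\<in>UNIV. \<Sum>p\<in>UNIV. \<Sum>q\<in>UNIV. sc (ant b q * mu p q i) (rho (mlt (rho c b) z) p))"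
    by (simp only: center_commute[OF assms])
  also have "\<dots> = mlt c (rho z i)"
  proof (rule mult_rho_left[of "\<lambda>x y. mlt y x", symmetric])
    \<comment> \<open>Commutativity of H makes rho multiplicative for the opposite product as
      well.\<close>
    show "rho (mlt y x) k = (\<Sum>i\<in>UNIV. \<Sum>j\<in>UNIV. sc (mu i j k) (mlt (rho y j) (rho x i)))" for x y k
      unfolding rho_mult by (subst sum.swap) (simp only: mu_commute)
  qed (simp_all only: mlt_sum_left mlt_sc_left)
  finally show "mlt (rho z i) c = mlt c (rho z i)" .
qed

lemma center_closed:
  "0 \<in> Z" "un1 \<in> Z"
  "x \<in> Z \<Longrightarrow> y \<in> Z \<Longrightarrow> x + y \<in> Z"
  "x \<in> Z \<Longrightarrow> y \<in> Z \<Longrightarrow> mlt x y \<in> Z"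
  "x \<in> Z \<Longrightarrow> sc c x \<in> Z"
  "x \<in> Z \<Longrightarrow> - x \<in> Z"
proof -
  show "mlt x y \<in> Z" if "x \<in> Z" "y \<in> Z"
    by (rule centerI) (metis mlt_assoc center_commute that)
qed (auto simp: center_def mlt_add_left mlt_add_right mlt_sc_left mlt_sc_right mlt_minus)

lemma center_sum: "(\<And>j. j \<in> J \<Longrightarrow> f j \<in> Z) \<Longrightarrow> (\<Sum>j\<in>J. f j) \<in> Z"
  by (induction J rule: infinite_finite_induct) (auto intro: center_closed)

definition Z0 :: "'c set" where "Z0 = {z \<in> Z. \<forall>i. rho z i = sc (un i) z}"

lemma Z0_center: "z \<in> Z0 \<Longrightarrow> z \<in> Z"
  by (simp add: Z0_def)

lemma mu_un_right: "(\<Sum>l\<in>UNIV. un l * mu i l q) = (if i = q then 1 else 0)"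
  using fun_cong[OF H.mlt_one_right[of "hbasis i"], of q]
  unfolding hmul_hbasis_left by (auto simp: hbasis_def)

lemma rho_mult_coinv:
  assumes "r \<in> Z0" shows "rho (mlt m r) q = mlt (rho m q) r"
proof -
  have "rho (mlt m r) q = (\<Sum>i\<in>UNIV. \<Sum>l\<in>UNIV. sc (un l * mu i l q) (mlt (rho m i) r))"
    using assms by (simp add: rho_mult Z0_def mlt_sc_right mult.commute)
  also have "\<dots> = mlt (rho m q) r"
    by (simp only: scale_sum_left[symmetric] mu_un_right sum_sc_delta)
  finally show ?thesis .
qed

text \<open>The Reynolds operator (id \<otimes> phi) rho.\<close>

definition tr :: "'c \<Rightarrow> 'c" where "tr c = (\<Sum>i\<in>UNIV. sc (phi i) (rho c i))"

lemma tr_add: "tr (x + y) = tr x + tr y"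
  by (simp add: tr_def rho_add scale_right_distrib sum.distrib)

lemma tr_one: "tr un1 = un1"
  by (simp add: tr_def rho_one mult.commute phi_un flip: scale_sum_left)

lemma tr_mlt: "r \<in> Z0 \<Longrightarrow> tr (mlt m r) = mlt (tr m) r"
  by (simp add: tr_def rho_mult_coinv mlt_sum_left mlt_sc_left)

text \<open>rho(t(z)) = z_0 \<otimes> z_1 phi(z_2), and the integral property collapses z_1 phi(z_2)
  to phi(z_1) 1.\<close>

lemma tr_closed:
  assumes "z \<in> Z" shows "tr z \<in> Z0"
proof -
  have "rho (tr z) a = sc (un a) (tr z)" for a
  proof -
    have "rho (tr z) a = (\<Sum>i\<in>UNIV. \<Sum>k\<in>UNIV. sc (com k a i * phi i) (rho z k))"
      by (simp add: tr_def rho_sum rho_sc rho_coassoc scale_sum_right mult.commute)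
    also have "\<dots> = (\<Sum>k\<in>UNIV. sc (\<Sum>i\<in>UNIV. com k a i * phi i) (rho z k))"
      by (subst sum.swap) (simp only: scale_sum_left)
    also have "\<dots> = sc (un a) (tr z)"
      by (simp only: phi_integral_coord tr_def scale_sum_right scale_scale mult.commute[of _ "un a"])
    finally show ?thesis .
  qed
  moreover have "tr z \<in> Z"
    unfolding tr_def by (intro center_sum center_closed center_rho assms)
  ultimately show ?thesis by (simp add: Z0_def)
qed

text \<open>Exhibits t(y d) as a combination of the coordinates of rho(d) with coefficients y_0
  phi(y_1 e_q). This links the trace forms to the canonical map.\<close>

lemma tr_mlt_expand:
  "tr (mlt y d) = (\<Sum>q\<in>UNIV. mlt (\<Sum>p\<in>UNIV. sc (phi_form p q) (rho y p)) (rho d q))"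
proof -
  have "tr (mlt y d) = (\<Sum>k\<in>UNIV. \<Sum>p\<in>UNIV. \<Sum>q\<in>UNIV. sc (mu p q k * phi k) (mlt (rho y p) (rho d q)))"
    by (simp add: tr_def rho_mult scale_sum_right mult.commute)
  also have "\<dots> = (\<Sum>q\<in>UNIV. \<Sum>p\<in>UNIV. \<Sum>k\<in>UNIV. sc (mu p q k * phi k) (mlt (rho y p) (rho d q)))"
    unfolding sum.cartesian_product UNIV_Times_UNIV
    by (rule sum.reindex_bij_witness[of _ "\<lambda>(q, p, k). (k, p, q)" "\<lambda>(k, p, q). (q, p, k)"]) auto
  finally show ?thesis
    by (simp only: phi_form_def scale_sum_left mlt_sum_left mlt_sc_left)
qed

lemma right_linear_form_tr:
  assumes "y \<in> Z" shows "right_linear_form mlt Z Z0 (\<lambda>d. tr (mlt y d))"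
proof
  show "tr (mlt y (mlt m r)) = mlt (tr (mlt y m)) r" if "r \<in> Z0" for m r
    using tr_mlt[OF that] by (simp add: mlt_assoc[symmetric])
qed (auto intro!: center_closed tr_closed assms simp: mlt_add_right tr_add dest: Z0_center)

lemma galois_can_zlin: "galois_can mlt rho s i = zlin (\<lambda>p. mlt (fst p) (rho (snd p) i)) s"
  by (simp add: galois_can_def zlin_def)

text \<open>The hypothesis provides a preimage of each 1 \<otimes> h under the canonical map of the
  centre. The choice h = e gives dual bases, hence faithful flatness and injectivity; basis vectors
  h give surjectivity. Families indexed by \<open>'x\<close> rather than formal sums allow
  multiplicities to be absorbed into \<open>u\<close>.\<close>

theorem centrally_galois_of_galois_elements:
  assumes ex: "\<And>h. \<exists>(I :: 'x set) u v. finite I \<and> (\<forall>p\<in>I. u p \<in> Z \<and> v p \<in> Z) \<and>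
      (\<forall>i. (\<Sum>p\<in>I. mlt (u p) (rho (v p) i)) = sc (h i) un1)"
  shows "hopf_galois mlt rho Z0 Z"
    and "faithfully_flat_over TYPE('n) \<lparr>carrier = Z0, monoid.mult = mlt, one = un1, zero = 0, add = (+)\<rparr> Z"
proof -
  obtain e where e: "\<And>q. (\<Sum>p\<in>UNIV. e p * phi_form p q) = eps q"
    using ex_dual_integral by blast
  obtain J :: "'x set" and x y where J: "finite J" "\<And>j. j \<in> J \<Longrightarrow> x j \<in> Z" "\<And>j. j \<in> J \<Longrightarrow> y j \<in> Z"
    and xy: "\<And>i. (\<Sum>j\<in>J. mlt (x j) (rho (y j) i)) = sc (e i) un1"
    using ex[of e] by blast
  define a where "a j q = (\<Sum>p\<in>UNIV. sc (phi_form p q) (rho (y j) p))" for j q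
  define \<tau> where "\<tau> j d = tr (mlt (y j) d)" for j d
  have \<tau>_eq: "\<tau> j d = (\<Sum>q\<in>UNIV. mlt (a j q) (rho d q))" for j d
    by (simp add: \<tau>_def tr_mlt_expand a_def)
  \<comment> \<open>The x_j \<otimes> y_j are sent to 1 \<otimes> e in total, so this sum is phi(e
    e_q) 1 = eps(e_q) 1.\<close>
  have xa: "(\<Sum>j\<in>J. mlt (x j) (a j q)) = sc (eps q) un1" for q
  proof -
    have "(\<Sum>j\<in>J. mlt (x j) (a j q)) = (\<Sum>p\<in>UNIV. sc (phi_form p q) (\<Sum>j\<in>J. mlt (x j) (rho (y j) p)))"
      unfolding a_def by (simp only: mlt_sum_right mlt_sc_right scale_sum_right) (rule sum.swap)
    also have "\<dots> = sc (\<Sum>p\<in>UNIV. e p * phi_form p q) un1"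
      by (simp only: xy scale_sum_left scale_scale mult.commute)
    finally show ?thesis by (simp only: e)
  qed
  interpret D: dual_basis mlt un1 Z Z0 J x \<tau>
  proof (rule dual_basis.intro)
    show "right_linear_form mlt Z Z0 (\<tau> j)" if "j \<in> J" for j
      unfolding \<tau>_def using right_linear_form_tr[OF J(3)[OF that]] .
    show "(\<Sum>j\<in>J. mlt (x j) (\<tau> j m)) = m" for m
    proof -
      have "(\<Sum>j\<in>J. mlt (x j) (\<tau> j m)) = (\<Sum>q\<in>UNIV. mlt (\<Sum>j\<in>J. mlt (x j) (a j q)) (rho m q))"
        unfolding \<tau>_eq by (simp only: mlt_sum_right mlt_sum_left mlt_assoc) (rule sum.swap)
      also have "\<dots> = m"
        by (simp add: xa mlt_sc_left rho_counit)
      finally show ?thesis .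
    qed
  qed (use J in \<open>auto intro: center_closed dest: Z0_center\<close>)
  have tr1: "right_linear_form mlt Z Z0 tr"
    using right_linear_form_tr[OF center_closed(2)] by simp
  show "faithfully_flat_over TYPE('n) \<lparr>carrier = Z0, monoid.mult = mlt, one = un1, zero = 0, add = (+)\<rparr> Z"
    by (rule D.faithfully_flat_over_dual_basis[OF tr1 center_closed(2) tr_one])
  show "hopf_galois mlt rho Z0 Z"
    unfolding hopf_galois_def
  proof (intro conjI allI impI)
    fix z :: "'i \<Rightarrow> 'c" assume z: "\<forall>i. z i \<in> Z"
    have "\<forall>i. \<exists>I u v. finite (I :: 'x set) \<and> (\<forall>p\<in>I. u p \<in> Z \<and> v p \<in> Z) \<and>
      (\<forall>k. (\<Sum>p\<in>I. mlt (u p) (rho (v p) k)) = sc (hbasis i k) un1)"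
      by (intro allI ex)
    from choice3[OF this] obtain I u v where Iuv: "\<forall>i. finite (I i :: 'x set) \<and>
      (\<forall>p\<in>I i. u i p \<in> Z \<and> v i p \<in> Z) \<and> (\<forall>k. (\<Sum>p\<in>I i. mlt (u i p) (rho (v i p) k)) = sc (hbasis i k) un1)"
      by (elim exE)
    then have uv: "\<And>i p. p \<in> I i \<Longrightarrow> u i p \<in> Z" "\<And>i p. p \<in> I i \<Longrightarrow> v i p \<in> Z"
      and sum: "\<And>i k. (\<Sum>p\<in>I i. mlt (u i p) (rho (v i p) k)) = sc (hbasis i k) un1"
      by simp_all
    \<comment> \<open>The canonical map is left linear: multiplying a preimage of 1 \<otimes> e_i by
      z_i and adding over i reaches z.\<close>
    define s where "s = (\<Sum>i\<in>UNIV. \<Sum>p\<in>I i. fsing (mlt (z i) (u i p), v i p))"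
    have f: "formal_on (fsing (mlt (z i) (u i p), v i p)) (Z \<times> Z)" if "p \<in> I i" for i p
      using uv that z by (intro formal_fsing) (auto intro: center_closed)
    have f': "formal_on (\<Sum>p\<in>I i. fsing (mlt (z i) (u i p), v i p)) (Z \<times> Z)" for i
      using f by (rule formal_sum)
    have "galois_can mlt rho s k = z k" for k
    proof -
      have "galois_can mlt rho s k = (\<Sum>i\<in>UNIV. \<Sum>p\<in>I i. mlt (mlt (z i) (u i p)) (rho (v i p) k))"
        unfolding galois_can_zlin s_def
        by (simp only: zlin_sum[OF f'] zlin_sum[OF f] zlin_fsing fst_conv snd_conv cong: sum.cong)
      also have "\<dots> = (\<Sum>i\<in>UNIV. mlt (z i) (sc (hbasis i k) un1))"
        by (simp only: mlt_assoc mlt_sum_right[symmetric] sum)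
      also have "\<dots> = z k"
        by (simp only: mlt_sc_right mlt_one_right hbasis_def sum_sc_delta)
      finally show ?thesis .
    qed
    moreover have "formal_on s (Z \<times> Z)" unfolding s_def by (intro formal_sum f')
    ultimately show "\<exists>s. formal_on s (Z \<times> Z) \<and> galois_can mlt rho s = z"
      by (intro exI[of _ s] conjI ext)
  next
    fix s assume s: "formal_on s (Z \<times> Z)" and zero: "galois_can mlt rho s = (\<lambda>_. 0)"
    interpret tensor_relations Z "(+)" Z "(+)" Z0 mlt mlt .
    have a: "a j q \<in> Z" if "j \<in> J" for j q
      unfolding a_def by (intro center_sum center_closed center_rho J(3) that)
    \<comment> \<open>The coefficients in \<open>tensor_self_expand\<close> are functions of the
      canonical image: m tau_j(n) = sum_q \<open>a j q\<close> m \<open>rho n q\<close>, since the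
      central \<open>a j q\<close> moves past m. A vanishing image therefore forces vanishing
      coefficients.\<close>
    have G: "zlin (\<lambda>p. mlt (fst p) (\<tau> j (snd p))) t = (\<Sum>q\<in>UNIV. mlt (a j q) (galois_can mlt rho t q))"
      if t: "formal_on t (Z \<times> Z)" and j: "j \<in> J" for t j
      using t
    proof (induction rule: formal_induct)
      case zero
      show ?case by (simp only: galois_can_zlin zlin_zero mlt_zero sum.neutral_const)
    next
      case (fsing p)
      have "mlt c (mlt (a j q) d) = mlt (a j q) (mlt c d)" for c d q
        by (metis mlt_assoc center_commute[OF a[OF j]])
      then show ?case by (simp only: galois_can_zlin zlin_fsing \<tau>_eq mlt_sum_right)
    next
      case (plus b c)
      then show ?case
        by (simp only: galois_can_zlin zlin_plus[OF plus(1,2)] mlt_add_right sum.distrib)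
    next
      case (uminus b)
      then show ?case by (simp only: galois_can_zlin zlin_uminus mlt_minus sum_negf)
    qed
    have "teq s ((\<Sum>j\<in>J. fsing (zlin (\<lambda>p. mlt (fst p) (\<tau> j (snd p))) s, x j)))"
      by (rule D.tensor_self_expand[OF _ mlt_add_left s center_closed(6)]) (erule center_commute)
    also have "\<dots> = (\<Sum>j\<in>J. fsing (0, x j))"
      by (intro sum.cong refl) (simp add: G[OF s] zero)
    also have "teq \<dots> ((\<Sum>j\<in>J. 0))"
      using J center_closed(1) by (intro teq_sum teq_zero_left) auto
    finally show "s \<in> tensor_rels Z (+) Z (+) Z0 mlt mlt"
      by (simp add: teq_zero)
  qed
qed

end

section \<open>Ore extensions\<close>

lemma coeff_lmul [simp]: "coeff (lmul a p) n = a * coeff p n"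
proof -
  have "coeff (lmul a p) n = (\<Sum>i\<le>degree p. if i = n then a * coeff p i else 0)"
    by (simp add: lmul_def coeff_sum)
  also have "\<dots> = a * coeff p n"
    by (simp add: coeff_eq_0)
  finally show ?thesis .
qed

lemma lmul_add_left: "lmul (a + b) p = lmul a p + lmul b p"
  and lmul_add_right: "lmul a (p + q) = lmul a p + lmul a q"
  and lmul_lmul: "lmul a (lmul b p) = lmul (a * b) p"
  and lmul_zero [simp]: "lmul a 0 = 0" "lmul 0 p = 0"
  and lmul_one [simp]: "lmul 1 p = p"
  and lmul_monom: "lmul a (monom b n) = monom (a * b) n"
  by (auto intro!: poly_eqI simp: distrib_left distrib_right mult.assoc)

text \<open>The identities below are additive in the left factor, so monomials suffice.\<close>

lemma poly_monom_induct [case_names zero monom add]: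
  assumes "P 0" "\<And>a n. P (monom a n)" "\<And>p q. P p \<Longrightarrow> P q \<Longrightarrow> P (p + q)"
  shows "P p"
proof -
  have "P (\<Sum>i\<in>I. monom (coeff p i) i)" for I
    by (induction I rule: infinite_finite_induct) (simp_all add: assms)
  from this[of "{..degree p}"] show ?thesis by (simp add: poly_as_sum_of_monoms)
qed

text \<open>Degrees may drop in a sum; a common bound N makes the defining sums of different left
  factors comparable.\<close>

lemma ore_mult_superset:
  assumes "degree p \<le> N"
  shows "ore_mult \<sigma> \<delta> p q = (\<Sum>n\<le>N. lmul (coeff p n) ((xmul \<sigma> \<delta> ^^ n) q))"
  unfolding ore_mult_def
  by (rule sum.mono_neutral_left) (use assms in \<open>auto simp: coeff_eq_0\<close>)

lemma ore_mult_add_left: "ore_mult \<sigma> \<delta> (p + p') q = ore_mult \<sigma> \<delta> p q + ore_mult \<sigma> \<delta> p' q"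
proof -
  define N where "N = max (degree p) (degree p')"
  have "degree p \<le> N" "degree p' \<le> N" "degree (p + p') \<le> N"
    by (auto simp: N_def intro: degree_add_le)
  then show ?thesis
    by (simp add: ore_mult_superset[of _ N] lmul_add_left sum.distrib)
qed

lemma ore_mult_monom: "ore_mult \<sigma> \<delta> (monom b n) q = lmul b ((xmul \<sigma> \<delta> ^^ n) q)"
proof -
  have "ore_mult \<sigma> \<delta> (monom b n) q = (\<Sum>m\<le>n. if m = n then lmul b ((xmul \<sigma> \<delta> ^^ n) q) else 0)"
    unfolding ore_mult_superset[OF degree_monom_le] by (intro sum.cong) auto
  then show ?thesis by simp
qed

lemma ore_mult_zero_left [simp]: "ore_mult \<sigma> \<delta> 0 q = 0"
  by (simp add: ore_mult_def)

lemma ore_mult_const: "ore_mult \<sigma> \<delta> [:b:] q = lmul b q"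
  using ore_mult_monom[of \<sigma> \<delta> b 0 q] by (simp add: monom_0)

lemma ore_mult_lmul: "ore_mult \<sigma> \<delta> (lmul a p) q = lmul a (ore_mult \<sigma> \<delta> p q)"
  by (induction p rule: poly_monom_induct)
    (simp_all add: lmul_monom ore_mult_monom lmul_lmul lmul_add_right ore_mult_add_left)

section \<open>Arithmetic of the Ore product\<close>

locale skew_derivation =
  fixes \<sigma> \<delta> :: "'a::ring_1 \<Rightarrow> 'a"
  assumes \<sigma>_add: "\<sigma> (a + b) = \<sigma> a + \<sigma> b"
    and \<sigma>_mult: "\<sigma> (a * b) = \<sigma> a * \<sigma> b"
    and \<sigma>_one [simp]: "\<sigma> 1 = 1"
    and \<delta>_add: "\<delta> (a + b) = \<delta> a + \<delta> b"
    and \<delta>_mult: "\<delta> (a * b) = \<sigma> a * \<delta> b + \<delta> a * b"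
begin

lemma \<sigma>_zero [simp]: "\<sigma> 0 = 0"
  using \<sigma>_add[of 0 0] by simp

lemma \<delta>_zero [simp]: "\<delta> 0 = 0"
  using \<delta>_add[of 0 0] by simp

lemma \<delta>_one [simp]: "\<delta> 1 = 0"
  using \<delta>_mult[of 1 1] by simp

abbreviation xm where "xm \<equiv> xmul \<sigma> \<delta>"
abbreviation om where "om \<equiv> ore_mult \<sigma> \<delta>"

lemma coeff_xmul: "coeff (xm p) n = (case n of 0 \<Rightarrow> 0 | Suc m \<Rightarrow> \<sigma> (coeff p m)) + \<delta> (coeff p n)"
proof -
  have "coeff (xm p) n = (\<Sum>i\<le>degree p. if Suc i = n then \<sigma> (coeff p i) else 0)
     + (\<Sum>i\<le>degree p. if i = n then \<delta> (coeff p i) else 0)"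
    by (simp add: xmul_def coeff_sum sum.distrib)
  also have "(\<Sum>i\<le>degree p. if i = n then \<delta> (coeff p i) else 0) = \<delta> (coeff p n)"
    by (simp add: coeff_eq_0)
  also have "(\<Sum>i\<le>degree p. if Suc i = n then \<sigma> (coeff p i) else 0) = (case n of 0 \<Rightarrow> 0 | Suc m \<Rightarrow> \<sigma> (coeff p m))"
    by (cases n) (simp_all add: coeff_eq_0)
  finally show ?thesis .
qed

lemma xmul_add: "xm (p + q) = xm p + xm q"
  by (rule poly_eqI) (simp add: coeff_xmul \<sigma>_add \<delta>_add split: nat.split)

text \<open>The commutation rule X a = sigma(a) X + delta(a) acting on p; multiplicativity of sigma
  and the twisted Leibniz rule are what it encodes.\<close>

lemma xmul_lmul: "xm (lmul a p) = lmul (\<sigma> a) (xm p) + lmul (\<delta> a) p"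
  by (rule poly_eqI) (simp add: coeff_xmul \<sigma>_mult \<delta>_mult distrib_left split: nat.split)

lemma xmul_monom: "xm (monom b n) = monom (\<sigma> b) (Suc n) + monom (\<delta> b) n"
  by (rule poly_eqI) (simp add: coeff_xmul split: nat.split)

lemma xmul_power_add: "(xm ^^ n) (p + q) = (xm ^^ n) p + (xm ^^ n) q"
  by (induction n) (simp_all add: xmul_add)

lemma ore_mult_add_right: "om p (q + q') = om p q + om p q'"
  by (simp add: ore_mult_def xmul_power_add lmul_add_right sum.distrib)

text \<open>Associativity with X as left factor, the core case: both terms of X (b X^n) reappear in
  \<open>xmul_lmul\<close>.\<close>

lemma ore_mult_xmul: "om (xm p) q = xm (om p q)"
proof (induction p rule: poly_monom_induct)
  case zero
  have "xm 0 = 0" by (simp add: xmul_def)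
  then show ?case by simp
qed (simp_all add: xmul_monom xmul_add ore_mult_monom ore_mult_add_left xmul_lmul)

lemma ore_mult_xmul_power: "om ((xm ^^ n) p) q = (xm ^^ n) (om p q)"
  by (induction n) (simp_all add: ore_mult_xmul)

text \<open>A left factor b X^n acts as \<open>xm\<close> iterated n times followed by
  \<open>lmul b\<close>, and both operations commute with right multiplication.\<close>

lemma ore_mult_assoc: "om (om p q) r = om p (om q r)"
  by (induction p rule: poly_monom_induct)
    (simp_all add: ore_mult_monom ore_mult_add_left ore_mult_lmul ore_mult_xmul_power)

lemma xmul_power_const:
  assumes "\<sigma> a = a" "\<delta> a = 0" shows "(xm ^^ n) [:a:] = monom a n"
  by (induction n) (simp_all add: assms xmul_monom monom_0)

lemma coeff_ore_mult_const:
  assumes "\<sigma> a = a" "\<delta> a = 0" shows "coeff (om p [:a:]) n = coeff p n * a"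
  by (induction p rule: poly_monom_induct)
    (simp_all add: ore_mult_monom ore_mult_add_left xmul_power_const[OF assms] distrib_right)

lemma ore_mult_one_right: "om p [:1:] = p"
  by (rule poly_eqI) (simp add: coeff_ore_mult_const)

lemma xmul_power_lmul_const:
  assumes "\<sigma> a = a" "\<delta> a = 0" shows "(xm ^^ n) (lmul a p) = lmul a ((xm ^^ n) p)"
  by (induction n) (simp_all add: assms xmul_lmul)

lemma ore_mult_lmul_right:
  assumes "\<sigma> a = a" "\<delta> a = 0" "\<And>b. a * b = b * a"
  shows "om p (lmul a q) = lmul a (om p q)"
  by (induction p rule: poly_monom_induct)
    (simp_all add: ore_mult_monom ore_mult_add_left xmul_power_lmul_const[OF assms(1,2)]
      lmul_lmul assms(3) lmul_add_right)

text \<open>Such constants commute with X because X a = sigma(a) X + delta(a) = a X, and with A by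
  assumption.\<close>

lemma const_in_center:
  assumes "\<sigma> a = a" "\<delta> a = 0" "\<And>b. a * b = b * a"
  shows "[:a:] \<in> center om UNIV"
  by (auto simp: center_def ore_mult_const coeff_ore_mult_const[OF assms(1,2)] assms(3) intro!: poly_eqI)

end

section \<open>A and its Ore extension as comodule algebras\<close>

lemma k_algebraD:
  assumes "k_algebra alg"
  shows "alg (x + y) = alg x + alg y" "alg (x * y) = alg x * alg y" "alg 1 = 1" "alg c * a = a * alg c"
  using assms unfolding k_algebra_def by blast+

lemma comodule_algebraD:
  assumes "comodule_algebra mu un com eps alg rho"
  shows "k_algebra alg" "rho (a + b) i = rho a i + rho b i" "rho (alg c * a) i = alg c * rho a i"
    "rho (rho a i) j = (\<Sum>k\<in>UNIV. alg (com k j i) * rho a k)"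
    "(\<Sum>k\<in>UNIV. alg (eps k) * rho a k) = a"
    "rho (a * b) k = (\<Sum>i\<in>UNIV. \<Sum>j\<in>UNIV. alg (mu i j k) * rho a i * rho b j)"
    "rho 1 k = alg (un k)"
  using assms unfolding comodule_algebra_def by blast+

lemma comod_alg_base:
  assumes H: "commutative_hopf_algebra mu un com eps ant"
    and A: "comodule_algebra mu un com eps alg rho"
  shows "comod_alg mu un com eps ant (\<lambda>c a. alg c * a) (*) 1 rho"
proof -
  note rho = comodule_algebraD[OF A]
  note alg = k_algebraD[OF rho(1)]
  show ?thesis
  proof unfold_locales
    show "x * (alg c * y) = alg c * (x * y)" for x y c
      by (metis alg(4) mult.assoc)
    show "rho (x * y) k = (\<Sum>i\<in>UNIV. \<Sum>j\<in>UNIV. alg (mu i j k) * (rho x i * rho y j))" for x y k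
      by (simp only: rho(6) mult.assoc)
    show "rho (rho x i) j = (\<Sum>k\<in>UNIV. alg (com k j i) * rho x k)" for x i j
      by (rule rho(4))
    show "(\<Sum>k\<in>UNIV. alg (eps k) * rho x k) = x" for x
      by (rule rho(5))
  qed (use H in \<open>simp_all add: alg(1-3) rho(2,3,7) distrib_left distrib_right mult.assoc\<close>)
qed

text \<open>The main point is multiplicativity of rho_T. For a monomial left factor it splits into
  the rule for A (\<open>rho_lmul\<close>) and compatibility with X (\<open>rho_xmul\<close>); the
  latter expresses that sigma and delta are comodule maps.\<close>

lemma comod_alg_ore:
  assumes H: "commutative_hopf_algebra mu un com eps ant"
    and A: "comodule_algebra mu un com eps alg rho"
    and sig: "k_algebra_endo alg \<sigma>"
    and del: "sigma_derivation alg \<sigma> \<delta>"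
    and sig_com: "comodule_map rho \<sigma>"
    and del_com: "comodule_map rho \<delta>"
  shows "comod_alg mu un com eps ant (\<lambda>c. lmul (alg c)) (ore_mult \<sigma> \<delta>) [:1:] (ore_rho rho)"
proof -
  interpret A: comod_alg mu un com eps ant "\<lambda>c a. alg c * a" "(*)" 1 rho
    by (rule comod_alg_base[OF H A])
  interpret skew_derivation \<sigma> \<delta>
    using sig del by unfold_locales (auto simp: k_algebra_endo_def sigma_derivation_def)
  note alg = k_algebraD[OF comodule_algebraD(1)[OF A]]
  \<comment> \<open>Hence scalars commute with X, as a K-algebra structure on T requires.\<close>
  have alg_\<sigma>: "\<sigma> (alg c) = alg c" and alg_\<delta>: "\<delta> (alg c) = 0" for c
  proof -
    have "\<sigma> (alg c * 1) = alg c * \<sigma> 1" using sig unfolding k_algebra_endo_def by blast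
    then show "\<sigma> (alg c) = alg c" by simp
    have "\<delta> (alg c * 1) = alg c * \<delta> 1" using del unfolding sigma_derivation_def by blast
    then show "\<delta> (alg c) = 0" by simp
  qed
  have coeff_rho: "coeff (ore_rho rho p i) n = rho (coeff p n) i" for p i n
    by (simp add: ore_rho_def coeff_map_poly)
  have rho_add: "ore_rho rho (p + q) i = ore_rho rho p i + ore_rho rho q i" for p q i
    by (rule poly_eqI) (simp add: coeff_rho A.rho_add)
  have rho_lmul: "ore_rho rho (lmul a q) k = (\<Sum>i\<in>UNIV. \<Sum>j\<in>UNIV. lmul (alg (mu i j k)) (lmul (rho a i) (ore_rho rho q j)))" for a q k
    by (rule poly_eqI) (simp add: coeff_rho A.rho_mult coeff_sum)
  have rho_xmul: "ore_rho rho (xm q) k = xm (ore_rho rho q k)" for q k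
    using sig_com del_com
    by (intro poly_eqI) (simp add: coeff_rho coeff_xmul A.rho_add comodule_map_def split: nat.split)
  have rho_xmul_power: "ore_rho rho ((xm ^^ n) q) k = (xm ^^ n) (ore_rho rho q k)" for n q k
    by (induction n) (simp_all add: rho_xmul)
  have rho_monom: "ore_rho rho (monom a n) k = monom (rho a k) n" for a n k
    by (rule poly_eqI) (simp add: coeff_rho)
  show ?thesis
  proof unfold_locales
    show "ore_rho rho (om p q) k = (\<Sum>i\<in>UNIV. \<Sum>j\<in>UNIV. lmul (alg (mu i j k)) (om (ore_rho rho p i) (ore_rho rho q j)))" for p q k
    proof (induction p rule: poly_monom_induct)
      case zero
      then show ?case by (simp add: ore_rho_def)
    next
      case (monom a n)
      then show ?case by (simp add: ore_mult_monom rho_monom rho_lmul rho_xmul_power)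
    next
      case (add p p')
      then show ?case by (simp add: ore_mult_add_left rho_add lmul_add_right sum.distrib)
    qed
    show "ore_rho rho (ore_rho rho p i) j = (\<Sum>k\<in>UNIV. lmul (alg (com k j i)) (ore_rho rho p k))" for p i j
      by (rule poly_eqI) (simp add: coeff_rho coeff_sum A.rho_coassoc)
    show "(\<Sum>k\<in>UNIV. lmul (alg (eps k)) (ore_rho rho p k)) = p" for p
      by (rule poly_eqI) (simp add: coeff_rho coeff_sum A.rho_counit)
    show "ore_rho rho (lmul (alg c) p) i = lmul (alg c) (ore_rho rho p i)" for c p i
      by (rule poly_eqI) (simp add: coeff_rho A.rho_sc)
    show "ore_rho rho [:1:] k = lmul (alg (un k)) [:1:]" for k
      by (rule poly_eqI) (simp add: coeff_rho coeff_pCons A.rho_one split: nat.split)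
    show "om p (lmul (alg c) q) = lmul (alg c) (om p q)" for c p q
      by (rule ore_mult_lmul_right) (simp_all add: alg_\<sigma> alg_\<delta> alg(4))
  qed (use H in \<open>simp_all add: alg(1-3) lmul_add_left lmul_add_right lmul_lmul ore_mult_add_left
      ore_mult_add_right ore_mult_assoc ore_mult_const ore_mult_one_right ore_mult_lmul rho_add\<close>)
qed

theorem theorem3p17:
  fixes mu :: "'i::finite \<Rightarrow> 'i \<Rightarrow> 'i \<Rightarrow> 'k::field_char_0"
    and un :: "'i \<Rightarrow> 'k" and com :: "'i \<Rightarrow> 'i \<Rightarrow> 'i \<Rightarrow> 'k"
    and eps :: "'i \<Rightarrow> 'k" and ant :: "'i \<Rightarrow> 'i \<Rightarrow> 'k"
    and alg :: "'k \<Rightarrow> 'a::ring_1" and rho :: "'a \<Rightarrow> 'i \<Rightarrow> 'a"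
    and \<sigma> \<delta> :: "'a \<Rightarrow> 'a"
    and B Z F :: "'a set" and S :: "'a poly set"
  assumes H: "commutative_hopf_algebra mu un com eps ant"
    and A: "comodule_algebra mu un com eps alg rho"
    and sig: "k_algebra_endo alg \<sigma>"
    and del: "sigma_derivation alg \<sigma> \<delta>"
    and sig_com: "comodule_map rho \<sigma>"
    and del_com: "comodule_map rho \<delta>"
    and B_def: "B = coinv (*) (\<lambda>i. alg (un i)) rho UNIV"
    and Z_def: "Z = center (*) (UNIV :: 'a set)"
    and F_def: "F = {a. \<sigma> a = a} \<inter> {a. \<delta> a = 0} \<inter> Z"
    and S_def: "S = {p :: 'a poly. \<forall>n. coeff p n \<in> B}"
  shows "comodule_subalgebra alg (*) rho Z
       \<and> comodule_subalgebra alg (*) rho F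
       \<and> coinv (*) (\<lambda>i. alg (un i)) rho F = {b\<in>B. \<sigma> b = b} \<inter> {b\<in>B. \<delta> b = 0} \<inter> Z
       \<and> (hopf_galois (*) rho ({b\<in>B. \<sigma> b = b} \<inter> {b\<in>B. \<delta> b = 0} \<inter> Z) F
           \<longrightarrow> centrally_galois TYPE('n) (ore_mult \<sigma> \<delta>) [:1:] (\<lambda>i. [:alg (un i):])
                 (ore_rho rho) S UNIV)"
proof -
  interpret A: comod_alg mu un com eps ant "\<lambda>c a. alg c * a" "(*)" 1 rho
    by (rule comod_alg_base[OF H A])
  interpret T: comod_alg mu un com eps ant "\<lambda>c. lmul (alg c)" "ore_mult \<sigma> \<delta>" "[:1:]" "ore_rho rho"
    by (rule comod_alg_ore[OF H A sig del sig_com del_com])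
  interpret skew_derivation \<sigma> \<delta>
    using sig del by unfold_locales (auto simp: k_algebra_endo_def sigma_derivation_def)
  note alg = k_algebraD[OF comodule_algebraD(1)[OF A]]
  have sig_alg: "\<sigma> (alg c * a) = alg c * \<sigma> a" and del_alg: "\<delta> (alg c * a) = alg c * \<delta> a" for c a
    using sig del by (auto simp: k_algebra_endo_def sigma_derivation_def)
  have algF: "alg c \<in> F" for c
    using sig_alg[of c 1] del_alg[of c 1] alg(4)[of c] by (simp add: F_def Z_def center_def)
  have F_add: "x + y \<in> F" if "x \<in> F" "y \<in> F" for x y
    using that by (auto simp: F_def Z_def \<sigma>_add \<delta>_add intro: A.center_closed)
  have F_mult: "x * y \<in> F" if "x \<in> F" "y \<in> F" for x y
    using that by (auto simp: F_def Z_def \<sigma>_mult \<delta>_mult intro: A.center_closed)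
  \<comment> \<open>sigma and delta commute with taking coordinates of rho, and rho sends 0 to
    0.\<close>
  have F_rho: "rho x i \<in> F" if "x \<in> F" for x i
    using that sig_com del_com A.center_rho[of x i] A.rho_zero[of i]
    unfolding F_def Z_def comodule_map_def by (metis (mono_tags, lifting) Int_iff mem_Collect_eq)
  have Z_sub: "comodule_subalgebra alg (*) rho Z"
    using algF by (auto simp: comodule_subalgebra_def F_def Z_def intro: A.center_closed A.center_rho)
  have F_sub: "comodule_subalgebra alg (*) rho F"
    using algF by (auto simp: comodule_subalgebra_def intro: F_add F_mult F_rho)
  have F_coinv: "coinv (*) (\<lambda>i. alg (un i)) rho F = {b\<in>B. \<sigma> b = b} \<inter> {b\<in>B. \<delta> b = 0} \<inter> Z"
    by (auto simp: coinv_def B_def F_def)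
  \<comment> \<open>Negatives in \<open>F\<close> are obtained by multiplying with the scalar
    -1.\<close>
  have alg_minus: "alg (- 1) = - 1"
    using alg(1)[of "- 1" 1] alg(1)[of 0 0] alg(3) by (simp add: eq_neg_iff_add_eq_0)
  have F_of_int: "of_int n * x \<in> F" if x: "x \<in> F" for n x
  proof (induction n rule: int_induct[where k = 0])
    case base
    show ?case using algF[of 0] alg(1)[of 0 0] by simp
  next
    case (step1 i)
    then show ?case using F_add[OF step1(2) x] by (simp add: distrib_right)
  next
    case (step2 i)
    have "- x \<in> F" using F_mult[OF algF[of "- 1"] x] by (simp add: alg_minus)
    then show ?case using F_add[OF step2(2)] by (fastforce simp: left_diff_distrib)
  qed
  have F_center: "[:x:] \<in> T.Z" if "x \<in> F" for x
    using that by (intro const_in_center) (auto simp: F_def Z_def center_def)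
  have coeff_rho: "coeff (ore_rho rho p i) n = rho (coeff p n) i" for p i n
    by (simp add: ore_rho_def coeff_map_poly)
  have "centrally_galois TYPE('n) (ore_mult \<sigma> \<delta>) [:1:] (\<lambda>i. [:alg (un i):]) (ore_rho rho) S UNIV"
    if gal: "hopf_galois (*) rho ({b\<in>B. \<sigma> b = b} \<inter> {b\<in>B. \<delta> b = 0} \<inter> Z) F"
  proof -
    have ex: "\<exists>(I :: ('a \<times> 'a) set) u v. finite I \<and> (\<forall>p\<in>I. u p \<in> T.Z \<and> v p \<in> T.Z) \<and>
      (\<forall>i. (\<Sum>p\<in>I. om (u p) (ore_rho rho (v p) i)) = lmul (alg (h i)) [:1:])" for h
    proof -
      have "\<forall>z. (\<forall>i. z i \<in> F) \<longrightarrow> (\<exists>s. formal_on s (F \<times> F) \<and> galois_can (*) rho s = z)"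
        using gal unfolding hopf_galois_def by (rule conjunct1)
      from this[rule_format, of "\<lambda>i. alg (h i)"] algF
      obtain s where s: "formal_on s (F \<times> F)" and can: "galois_can (*) rho s = (\<lambda>i. alg (h i))"
        by blast
      \<comment> \<open>The integer multiplicities of the formal sum are absorbed into the first
        factors, which stay in \<open>F\<close> by \<open>F_of_int\<close>.\<close>
      define u where "u p = [:of_int (s p) * fst p:]" for p
      define v where "v p = [:snd p:]" for p :: "'a \<times> 'a"
      have "(\<Sum>p\<in>fsupp s. om (u p) (ore_rho rho (v p) i)) = lmul (alg (h i)) [:1:]" for i
      proof (rule poly_eqI)
        fix n
        \<comment> \<open>Constants multiply as in A, so the constant coefficient reproduces the
          canonical map of A and all others vanish.\<close>
        have "coeff (om (u p) (ore_rho rho (v p) i)) n =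
            (if n = 0 then zmul (s p) (fst p * rho (snd p) i) else 0)" for p
          by (cases n) (simp_all add: u_def v_def ore_mult_const coeff_rho zmul_ring mult.assoc)
        then have "coeff (\<Sum>p\<in>fsupp s. om (u p) (ore_rho rho (v p) i)) n =
            (if n = 0 then galois_can (*) rho s i else 0)"
          by (simp add: coeff_sum galois_can_def)
        then show "coeff (\<Sum>p\<in>fsupp s. om (u p) (ore_rho rho (v p) i)) n = coeff (lmul (alg (h i)) [:1:]) n"
          by (simp add: can coeff_pCons split: nat.split)
      qed
      moreover have "u p \<in> T.Z \<and> v p \<in> T.Z" if "p \<in> fsupp s" for p
        using s that by (auto simp: formal_on_def u_def v_def intro!: F_center F_of_int)
      moreover have "finite (fsupp s)" using s by (simp add: formal_on_def)
      ultimately show ?thesis by (intro exI[of _ "fsupp s"] exI[of _ u] exI[of _ v]) auto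
    qed
    \<comment> \<open>Multiplying by the constant \<open>alg (un i)\<close> in T is the scalar
      action, so both descriptions of the coinvariants agree.\<close>
    have Z0: "coinv om (\<lambda>i. [:alg (un i):]) (ore_rho rho) T.Z = T.Z0"
      by (simp add: coinv_def T.Z0_def ore_mult_const)
    \<comment> \<open>rho_T works coefficientwise, so a polynomial is coinvariant exactly when its
      coefficients are.\<close>
    have S: "S = coinv om (\<lambda>i. [:alg (un i):]) (ore_rho rho) UNIV"
      by (auto simp: S_def B_def coinv_def ore_mult_const poly_eq_iff coeff_rho)
    show ?thesis
      unfolding centrally_galois_def Let_def Z0
      using S T.center_rho T.centrally_galois_of_galois_elements[OF ex] by blast
  qed
  with Z_sub F_sub F_coinv show ?thesis by blast
qed

end
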